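(* Let $E$ be a countable directed graph such that each vertex of $E$ emits finitely many edges, each vertex emits at least one edge, and each vertex receives at least one edge. Then the gauge action $\gamma:\mathbb{T}\to\operatorname{Aut}(C^*(E))$ is principal.
   Context: A directed graph $E$ consists of a set of vertices $E^0$, a set of directed edges $E^1$, and source and range maps $s,r:E^1\to E^0$ (loops and multiple edges are allowed); it is countable if $E^0$ and $E^1$ are countable. A vertex $v$ emits the edges $e$ with $s(e)=v$ and receives the edges $e$ with $r(e)=v$. Graph algebra: for a graph $E$ in which every vertex emits only finitely many edges, $C^*(E)$ is the universal $C^*$-algebra generated by partial isometries $\{S_e : e\in E^1\}$ with mutually orthogonal ranges and mutually orthogonal projections $\{P_v : v\in E^0\}$ such that $S_e^*S_e=P_{r(e)}$ for each $e\in E^1$, and $P_v=\sum_{s(f)=v}S_fS_f^*$ for each $v\in E^0$ emitting at least one edge. Gauge action: $\mathbb{T}=\{t\in\mathbb{C}:|t|=1\}$ and $\gamma:\mathbb{T}\to\operatorname{Aut}(C^*(E))$ is the action determined by $\gamma_t(S_e)=tS_e$ and $\gamma_t(P_v)=P_v$ for all $e\in E^1$, $v\in E^0$, $t\in\mathbb{T}$. Principal action (in the sense of Ellwood, for compact groups): let a compact group $\Gamma$ act on a $C^*$-algebra $\mathcal{A}$ (not necessarily unital) by $\alpha:\Gamma\to\operatorname{Aut}(\mathcal{A})$ (point-norm continuous). Identify $\mathcal{A}\otimes C(\Gamma)$ with $C(\Gamma,\mathcal{A})$, and let $\delta:\mathcal{A}\to\mathcal{A}\otimes C(\Gamma)$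 be the corresponding coaction, $\delta(a)(g)=\alpha_g(a)$. The action is called principal if the linear map $\Phi:\mathcal{A}\otimes_{\rm alg}\mathcal{A}\to\mathcal{A}\otimes C(\Gamma)$, $\Phi(x\otimes y)=(x\otimes I)\delta(y)$ (that is, $\Phi(x\otimes y)(g)=x\,\alpha_g(y)$), has norm-dense range. *)

theory Defs
  imports
    "HOL-Analysis.Analysis"
    "HOL-Algebra.FiniteProduct"
    "Graph_Theory.Digraph"
begin

section \<open>C*-algebras\<close>

text \<open>
  C*-algebras are given by a carrier set, since universal properties quantify over them. A unit is
  not required, which is why the record does not extend the rings of HOL-Algebra.
\<close>

record 'a cstar = "'a partial_object" +
  cadd :: "'a \<Rightarrow> 'a \<Rightarrow> 'a" (infixl "\<oplus>\<index>" 65)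
  czero :: 'a ("\<zero>\<index>")
  cscale :: "complex \<Rightarrow> 'a \<Rightarrow> 'a" (infixr "\<odot>\<index>" 75)
  cmult :: "'a \<Rightarrow> 'a \<Rightarrow> 'a" (infixl "\<cdot>\<index>" 70)
  cadj :: "'a \<Rightarrow> 'a" ("_\<^sup>\<star>\<index>" [1000] 999)
  cnorm :: "'a \<Rightarrow> real" ("\<parallel>_\<parallel>\<index>")

definition add_group :: "('a, 'm) cstar_scheme \<Rightarrow> 'a monoid" where
  "add_group A = \<lparr>carrier = carrier A, mult = cadd A, one = czero A\<rparr>"

definition csum :: "('a, 'm) cstar_scheme \<Rightarrow> ('i \<Rightarrow> 'a) \<Rightarrow> 'i set \<Rightarrow> 'a" where
  "csum A = finprod (add_group A)"

definition cminus :: "('a, 'm) cstar_scheme \<Rightarrow> 'a \<Rightarrow> 'a \<Rightarrow> 'a" (infixl "\<ominus>\<index>" 65) where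
  "x \<ominus>\<^bsub>A\<^esub> y = x \<oplus>\<^bsub>A\<^esub> (-1) \<odot>\<^bsub>A\<^esub> y"

text \<open>
  The distance is 0 off the carrier because \<^locale>\<open>Metric_space\<close> requires nonnegativity and
  symmetry on the whole type.
\<close>

definition cdist :: "('a, 'm) cstar_scheme \<Rightarrow> 'a \<Rightarrow> 'a \<Rightarrow> real" where
  "cdist A x y = (if x \<in> carrier A \<and> y \<in> carrier A then \<parallel>x \<ominus>\<^bsub>A\<^esub> y\<parallel>\<^bsub>A\<^esub> else 0)"

definition norm_topology :: "('a, 'm) cstar_scheme \<Rightarrow> 'a topology" where
  "norm_topology A = Metric_space.mtopology (carrier A) (cdist A)"

locale cstar_algebra =
  fixes A :: "('a, 'm) cstar_scheme" (structure)
  assumes add_comm_group: "comm_group (add_group A)"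
    and scale_closed: "x \<in> carrier A \<Longrightarrow> c \<odot> x \<in> carrier A"
    and mult_closed: "\<lbrakk>x \<in> carrier A; y \<in> carrier A\<rbrakk> \<Longrightarrow> x \<cdot> y \<in> carrier A"
    and adj_closed: "x \<in> carrier A \<Longrightarrow> x\<^sup>\<star> \<in> carrier A"
    and scale_add_right:
      "\<lbrakk>x \<in> carrier A; y \<in> carrier A\<rbrakk> \<Longrightarrow> c \<odot> (x \<oplus> y) = c \<odot> x \<oplus> c \<odot> y"
    and scale_add_left: "x \<in> carrier A \<Longrightarrow> (c + d) \<odot> x = c \<odot> x \<oplus> d \<odot> x"
    and scale_scale: "x \<in> carrier A \<Longrightarrow> c \<odot> d \<odot> x = (c * d) \<odot> x"
    and scale_one: "x \<in> carrier A \<Longrightarrow> 1 \<odot> x = x"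
    and mult_assoc:
      "\<lbrakk>x \<in> carrier A; y \<in> carrier A; z \<in> carrier A\<rbrakk> \<Longrightarrow> x \<cdot> y \<cdot> z = x \<cdot> (y \<cdot> z)"
    and distrib_left:
      "\<lbrakk>x \<in> carrier A; y \<in> carrier A; z \<in> carrier A\<rbrakk> \<Longrightarrow> x \<cdot> (y \<oplus> z) = x \<cdot> y \<oplus> x \<cdot> z"
    and distrib_right:
      "\<lbrakk>x \<in> carrier A; y \<in> carrier A; z \<in> carrier A\<rbrakk> \<Longrightarrow> (x \<oplus> y) \<cdot> z = x \<cdot> z \<oplus> y \<cdot> z"
    and scale_mult_left:
      "\<lbrakk>x \<in> carrier A; y \<in> carrier A\<rbrakk> \<Longrightarrow> (c \<odot> x) \<cdot> y = c \<odot> (x \<cdot> y)"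
    and scale_mult_right:
      "\<lbrakk>x \<in> carrier A; y \<in> carrier A\<rbrakk> \<Longrightarrow> x \<cdot> (c \<odot> y) = c \<odot> (x \<cdot> y)"
    and adj_adj: "x \<in> carrier A \<Longrightarrow> (x\<^sup>\<star>)\<^sup>\<star> = x"
    and adj_add: "\<lbrakk>x \<in> carrier A; y \<in> carrier A\<rbrakk> \<Longrightarrow> (x \<oplus> y)\<^sup>\<star> = x\<^sup>\<star> \<oplus> y\<^sup>\<star>"
    and adj_scale: "x \<in> carrier A \<Longrightarrow> (c \<odot> x)\<^sup>\<star> = cnj c \<odot> x\<^sup>\<star>"
    and adj_mult: "\<lbrakk>x \<in> carrier A; y \<in> carrier A\<rbrakk> \<Longrightarrow> (x \<cdot> y)\<^sup>\<star> = y\<^sup>\<star> \<cdot> x\<^sup>\<star>"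
    and norm_nonneg: "x \<in> carrier A \<Longrightarrow> 0 \<le> \<parallel>x\<parallel>"
    and norm_eq_zero: "x \<in> carrier A \<Longrightarrow> \<parallel>x\<parallel> = 0 \<longleftrightarrow> x = \<zero>"
    and norm_triangle: "\<lbrakk>x \<in> carrier A; y \<in> carrier A\<rbrakk> \<Longrightarrow> \<parallel>x \<oplus> y\<parallel> \<le> \<parallel>x\<parallel> + \<parallel>y\<parallel>"
    and norm_scale: "x \<in> carrier A \<Longrightarrow> \<parallel>c \<odot> x\<parallel> = cmod c * \<parallel>x\<parallel>"
    and norm_mult: "\<lbrakk>x \<in> carrier A; y \<in> carrier A\<rbrakk> \<Longrightarrow> \<parallel>x \<cdot> y\<parallel> \<le> \<parallel>x\<parallel> * \<parallel>y\<parallel>"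
    and norm_cstar: "x \<in> carrier A \<Longrightarrow> \<parallel>x\<^sup>\<star> \<cdot> x\<parallel> = \<parallel>x\<parallel>\<^sup>2"
    and complete: "Metric_space.mcomplete (carrier A) (cdist A)"

definition star_hom ::
    "('a, 'm) cstar_scheme \<Rightarrow> ('b, 'n) cstar_scheme \<Rightarrow> ('a \<Rightarrow> 'b) \<Rightarrow> bool" where
  "star_hom A B \<phi> \<longleftrightarrow>
     \<phi> \<in> carrier A \<rightarrow> carrier B \<and>
     (\<forall>x\<in>carrier A. \<forall>y\<in>carrier A. \<phi> (x \<oplus>\<^bsub>A\<^esub> y) = \<phi> x \<oplus>\<^bsub>B\<^esub> \<phi> y) \<and>
     (\<forall>c. \<forall>x\<in>carrier A. \<phi> (c \<odot>\<^bsub>A\<^esub> x) = c \<odot>\<^bsub>B\<^esub> \<phi> x) \<and>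
     (\<forall>x\<in>carrier A. \<forall>y\<in>carrier A. \<phi> (x \<cdot>\<^bsub>A\<^esub> y) = \<phi> x \<cdot>\<^bsub>B\<^esub> \<phi> y) \<and>
     (\<forall>x\<in>carrier A. \<phi> (x\<^sup>\<star>\<^bsub>A\<^esub>) = (\<phi> x)\<^sup>\<star>\<^bsub>B\<^esub>)"

definition star_aut :: "('a, 'm) cstar_scheme \<Rightarrow> ('a \<Rightarrow> 'a) \<Rightarrow> bool" where
  "star_aut A \<phi> \<longleftrightarrow> star_hom A A \<phi> \<and> bij_betw \<phi> (carrier A) (carrier A)"

definition closed_star_subalgebra :: "'a set \<Rightarrow> ('a, 'm) cstar_scheme \<Rightarrow> bool" where
  "closed_star_subalgebra D A \<longleftrightarrow>
     closedin (norm_topology A) D \<and>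
     \<zero>\<^bsub>A\<^esub> \<in> D \<and>
     (\<forall>x\<in>D. \<forall>y\<in>D. x \<oplus>\<^bsub>A\<^esub> y \<in> D \<and> x \<cdot>\<^bsub>A\<^esub> y \<in> D) \<and>
     (\<forall>c. \<forall>x\<in>D. c \<odot>\<^bsub>A\<^esub> x \<in> D) \<and>
     (\<forall>x\<in>D. x\<^sup>\<star>\<^bsub>A\<^esub> \<in> D)"

definition generates :: "'a set \<Rightarrow> ('a, 'm) cstar_scheme \<Rightarrow> bool" where
  "generates M A \<longleftrightarrow>
     M \<subseteq> carrier A \<and> (\<forall>D. closed_star_subalgebra D A \<and> M \<subseteq> D \<longrightarrow> D = carrier A)"

section \<open>Principal actions of compact groups\<close>

locale compact_group = group G
  for G :: "('g, 'k) monoid_scheme" (structure) and X :: "'g topology" +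
  assumes topspace: "topspace X = carrier G"
    and continuous_mult: "continuous_map (prod_topology X X) X (\<lambda>(g, h). g \<otimes> h)"
    and continuous_inv: "continuous_map X X (\<lambda>g. inv g)"
    and compact: "compact_space X"
    and Hausdorff: "Hausdorff_space X"

definition cstar_action ::
    "('g, 'k) monoid_scheme \<Rightarrow> 'g topology \<Rightarrow> ('a, 'm) cstar_scheme \<Rightarrow> ('g \<Rightarrow> 'a \<Rightarrow> 'a) \<Rightarrow> bool" where
  "cstar_action G X A \<alpha> \<longleftrightarrow>
     compact_group G X \<and> cstar_algebra A \<and>
     (\<forall>g\<in>carrier G. star_aut A (\<alpha> g)) \<and>
     (\<forall>g\<in>carrier G. \<forall>h\<in>carrier G. \<forall>a\<in>carrier A. \<alpha> (g \<otimes>\<^bsub>G\<^esub> h) a = \<alpha> g (\<alpha> h a)) \<and>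
     (\<forall>a\<in>carrier A. continuous_map X (norm_topology A) (\<lambda>g. \<alpha> g a))"

text \<open>
  The C*-algebra of continuous functions from a nonempty compact space to \<open>A\<close>, as functions that are
  \<^const>\<open>undefined\<close> off the space; it is the usual model of the tensor product of \<open>A\<close> with the
  continuous scalar functions.
\<close>

definition continuous_functions :: "'g topology \<Rightarrow> ('a, 'm) cstar_scheme \<Rightarrow> ('g \<Rightarrow> 'a) cstar" where
  "continuous_functions X A =
     \<lparr>carrier = {f \<in> extensional (topspace X). continuous_map X (norm_topology A) f},
      cadd = (\<lambda>f h. \<lambda>g\<in>topspace X. f g \<oplus>\<^bsub>A\<^esub> h g),
      czero = (\<lambda>g\<in>topspace X. \<zero>\<^bsub>A\<^esub>),
      cscale = (\<lambda>c f. \<lambda>g\<in>topspace X. c \<odot>\<^bsub>A\<^esub> f g),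
      cmult = (\<lambda>f h. \<lambda>g\<in>topspace X. f g \<cdot>\<^bsub>A\<^esub> h g),
      cadj = (\<lambda>f. \<lambda>g\<in>topspace X. (f g)\<^sup>\<star>\<^bsub>A\<^esub>),
      cnorm = (\<lambda>f. SUP g\<in>topspace X. \<parallel>f g\<parallel>\<^bsub>A\<^esub>)\<rparr>"

text \<open>
  The range of the linear map on the algebraic tensor square of \<open>A\<close> sending \<open>x \<otimes> y\<close> to the function
  \<open>g \<mapsto> x \<cdot> \<alpha> g y\<close>: tensors are the finite sums of elementary tensors.
\<close>

definition ellwood_range ::
    "'g topology \<Rightarrow> ('a, 'm) cstar_scheme \<Rightarrow> ('g \<Rightarrow> 'a \<Rightarrow> 'a) \<Rightarrow> ('g \<Rightarrow> 'a) set" where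
  "ellwood_range X A \<alpha> =
     {(\<lambda>g\<in>topspace X. csum A (\<lambda>i. x i \<cdot>\<^bsub>A\<^esub> \<alpha> g (y i)) {..<n}) | x y (n::nat).
        \<forall>i<n. x i \<in> carrier A \<and> y i \<in> carrier A}"

definition principal_action ::
    "('g, 'k) monoid_scheme \<Rightarrow> 'g topology \<Rightarrow> ('a, 'm) cstar_scheme \<Rightarrow> ('g \<Rightarrow> 'a \<Rightarrow> 'a) \<Rightarrow> bool" where
  "principal_action G X A \<alpha> \<longleftrightarrow>
     cstar_action G X A \<alpha> \<and>
     (let C = continuous_functions X A in
       \<forall>f\<in>carrier C. \<forall>\<epsilon>>0. \<exists>h\<in>ellwood_range X A \<alpha>. \<parallel>f \<ominus>\<^bsub>C\<^esub> h\<parallel>\<^bsub>C\<^esub> < \<epsilon>)"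

section \<open>Graph algebras\<close>

text \<open>Sources and ranges of edges are their tails and heads.\<close>

definition ck_family ::
    "('v, 'e) pre_digraph \<Rightarrow> ('a, 'm) cstar_scheme \<Rightarrow> ('e \<Rightarrow> 'a) \<Rightarrow> ('v \<Rightarrow> 'a) \<Rightarrow> bool" where
  "ck_family E A S P \<longleftrightarrow>
     (\<forall>e\<in>arcs E. S e \<in> carrier A \<and> S e \<cdot>\<^bsub>A\<^esub> (S e)\<^sup>\<star>\<^bsub>A\<^esub> \<cdot>\<^bsub>A\<^esub> S e = S e) \<and>
     (\<forall>e\<in>arcs E. \<forall>f\<in>arcs E. e \<noteq> f \<longrightarrow>
        (S e \<cdot>\<^bsub>A\<^esub> (S e)\<^sup>\<star>\<^bsub>A\<^esub>) \<cdot>\<^bsub>A\<^esub> (S f \<cdot>\<^bsub>A\<^esub> (S f)\<^sup>\<star>\<^bsub>A\<^esub>) = \<zero>\<^bsub>A\<^esub>) \<and>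
     (\<forall>v\<in>verts E. P v \<in> carrier A \<and> P v \<cdot>\<^bsub>A\<^esub> P v = P v \<and> (P v)\<^sup>\<star>\<^bsub>A\<^esub> = P v) \<and>
     (\<forall>v\<in>verts E. \<forall>w\<in>verts E. v \<noteq> w \<longrightarrow> P v \<cdot>\<^bsub>A\<^esub> P w = \<zero>\<^bsub>A\<^esub>) \<and>
     (\<forall>e\<in>arcs E. (S e)\<^sup>\<star>\<^bsub>A\<^esub> \<cdot>\<^bsub>A\<^esub> S e = P (head E e)) \<and>
     (\<forall>v\<in>verts E. out_arcs E v \<noteq> {} \<longrightarrow>
        P v = csum A (\<lambda>f. S f \<cdot>\<^bsub>A\<^esub> (S f)\<^sup>\<star>\<^bsub>A\<^esub>) (out_arcs E v))"

text \<open>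
  HOL cannot quantify over C*-algebras on all types, but a single large type suffices for the
  universal property. In a C*-algebra generated by a family indexed by the vertices and edges, every
  element is the limit of a sequence of *-polynomials in the generators; choosing such a sequence
  for each element identifies the carrier with a set of sequences of formal *-polynomials. So every
  C*-algebra generated by a family is isomorphic to one on the type \<open>('v, 'e) label\<close>, and a
  family in an arbitrary C*-algebra lives in the C*-subalgebra it generates.
\<close>

datatype ('v, 'e) star_polynomial =
    Vertex 'v
  | Edge 'e
  | Add "('v, 'e) star_polynomial" "('v, 'e) star_polynomial"
  | Scale complex "('v, 'e) star_polynomial"
  | Mult "('v, 'e) star_polynomial" "('v, 'e) star_polynomial"
  | Adj "('v, 'e) star_polynomial"

type_synonym ('v, 'e) label = "nat \<Rightarrow> ('v, 'e) star_polynomial"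

text \<open>
  \<open>A\<close> with the family \<open>S\<close>, \<open>P\<close> is the C*-algebra of the row-finite graph \<open>E\<close>. The homomorphism
  given by the universal property is unique, as \<open>A\<close> is generated by the family.
\<close>

definition graph_cstar_algebra ::
    "('v, 'e) pre_digraph \<Rightarrow> ('a, 'm) cstar_scheme \<Rightarrow> ('e \<Rightarrow> 'a) \<Rightarrow> ('v \<Rightarrow> 'a) \<Rightarrow> bool" where
  "graph_cstar_algebra E A S P \<longleftrightarrow>
     cstar_algebra A \<and> ck_family E A S P \<and> generates (S ` arcs E \<union> P ` verts E) A \<and>
     (\<forall>(B :: ('v, 'e) label cstar) T Q. cstar_algebra B \<and> ck_family E B T Q \<longrightarrow>
        (\<exists>\<phi>. star_hom A B \<phi> \<and> (\<forall>e\<in>arcs E. \<phi> (S e) = T e) \<and> (\<forall>v\<in>verts E. \<phi> (P v) = Q v)))"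

definition circle_group :: "complex monoid" where
  "circle_group = \<lparr>carrier = sphere 0 1, mult = (*), one = 1\<rparr>"

definition circle_topology :: "complex topology" where
  "circle_topology = top_of_set (sphere 0 1)"

definition gauge_action ::
    "('v, 'e) pre_digraph \<Rightarrow> ('a, 'm) cstar_scheme \<Rightarrow> ('e \<Rightarrow> 'a) \<Rightarrow> ('v \<Rightarrow> 'a) \<Rightarrow>
      (complex \<Rightarrow> 'a \<Rightarrow> 'a) \<Rightarrow> bool" where
  "gauge_action E A S P \<gamma> \<longleftrightarrow>
     cstar_action circle_group circle_topology A \<gamma> \<and>
     (\<forall>t\<in>sphere 0 1. (\<forall>e\<in>arcs E. \<gamma> t (S e) = t \<odot>\<^bsub>A\<^esub> S e) \<and> (\<forall>v\<in>verts E. \<gamma> t (P v) = P v))"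

end

theory Submission
  imports Defs
begin

text \<open>
  For an integer \<open>n\<close>, let \<open>M\<^sub>n\<close> (below: \<open>twisted n\<close>) be the set of all \<open>a\<close> for which the function
  \<open>t \<mapsto> t\<^sup>n a\<close> lies in the closure of the Ellwood range. It is a closed left ideal, and \<open>M\<^sub>n b\<close> is
  contained in \<open>M\<^sub>n\<^sub>+\<^sub>k\<close> if \<open>b\<close> is homogeneous of degree \<open>k\<close> for the gauge action. All \<open>P\<^sub>v\<close> lie in \<open>M\<^sub>0\<close>.
  If \<open>e\<close> is an edge into \<open>v\<close>, then \<open>P\<^sub>v = S\<^sub>e\<^sup>* P\<^bsub>s(e)\<^esub> S\<^sub>e\<close>, so inductively \<open>P\<^sub>v\<close> lies in \<open>M\<^sub>n\<close> for
  \<open>n \<ge> 0\<close>; and \<open>P\<^sub>v\<close> is the sum of \<open>S\<^sub>e P\<^bsub>r(e)\<^esub> S\<^sub>e\<^sup>*\<close> over the edges out of \<open>v\<close>, so it lies in \<open>M\<^sub>n\<close>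
  for \<open>n \<le> 0\<close> too. As \<open>M\<^sub>n\<close> is a left ideal, the elements \<open>a\<close> such that \<open>a\<close> and \<open>a\<^sup>*\<close> are in \<open>M\<^sub>n\<close>
  form a closed *-subalgebra, which contains the generators; hence \<open>M\<^sub>n\<close> is everything. Thus the
  closure of the range contains all trigonometric polynomials with coefficients in the algebra, and
  these are dense by a partition of unity and the Stone-Weierstrass theorem.
\<close>

section \<open>Vector space and metric structure of a C*-algebra\<close>

context cstar_algebra
begin

text \<open>The additive laws are packed into \<open>comm_group (add_group A)\<close>. Unfolding
  \<open>add_group\<close> carries the group facts over to the operations of the record.\<close>

lemma add_closed [simp]: "\<lbrakk>x \<in> carrier A; y \<in> carrier A\<rbrakk> \<Longrightarrow> x \<oplus> y \<in> carrier A"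
  and zero_closed [simp]: "\<zero> \<in> carrier A"
  and add_assoc: "\<lbrakk>x \<in> carrier A; y \<in> carrier A; z \<in> carrier A\<rbrakk> \<Longrightarrow> x \<oplus> y \<oplus> z = x \<oplus> (y \<oplus> z)"
  and add_comm: "\<lbrakk>x \<in> carrier A; y \<in> carrier A\<rbrakk> \<Longrightarrow> x \<oplus> y = y \<oplus> x"
  and add_zero_left [simp]: "x \<in> carrier A \<Longrightarrow> \<zero> \<oplus> x = x"
  and add_zero_right [simp]: "x \<in> carrier A \<Longrightarrow> x \<oplus> \<zero> = x"
  and add_left_cancel: "\<lbrakk>x \<in> carrier A; y \<in> carrier A; z \<in> carrier A\<rbrakk> \<Longrightarrow> x \<oplus> y = x \<oplus> z \<longleftrightarrow> y = z"
proof -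
  interpret comm_group "add_group A"
    by (rule add_comm_group)
  show "\<lbrakk>x \<in> carrier A; y \<in> carrier A\<rbrakk> \<Longrightarrow> x \<oplus> y \<in> carrier A"
    "\<zero> \<in> carrier A"
    "\<lbrakk>x \<in> carrier A; y \<in> carrier A; z \<in> carrier A\<rbrakk> \<Longrightarrow> x \<oplus> y \<oplus> z = x \<oplus> (y \<oplus> z)"
    "\<lbrakk>x \<in> carrier A; y \<in> carrier A\<rbrakk> \<Longrightarrow> x \<oplus> y = y \<oplus> x"
    "x \<in> carrier A \<Longrightarrow> \<zero> \<oplus> x = x"
    "x \<in> carrier A \<Longrightarrow> x \<oplus> \<zero> = x"
    "\<lbrakk>x \<in> carrier A; y \<in> carrier A; z \<in> carrier A\<rbrakk> \<Longrightarrow> x \<oplus> y = x \<oplus> z \<longleftrightarrow> y = z"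
    using m_closed[of x y] one_closed m_assoc[of x y z] m_comm[of x y] l_one[of x] r_one[of x]
      Units_l_cancel[of x y z] Units_eq
    by (auto simp: add_group_def)
qed

lemmas closed_simps [simp] = scale_closed mult_closed adj_closed

lemma add_left_comm:
  "\<lbrakk>x \<in> carrier A; y \<in> carrier A; z \<in> carrier A\<rbrakk> \<Longrightarrow> x \<oplus> (y \<oplus> z) = y \<oplus> (x \<oplus> z)"
  by (metis add_assoc add_comm)

lemmas add_ac = add_assoc add_comm add_left_comm

lemma scale_zero_left [simp]:
  assumes "x \<in> carrier A" shows "0 \<odot> x = \<zero>"
  using scale_add_left[OF assms, of 0 0] add_left_cancel[of "0 \<odot> x" "0 \<odot> x" \<zero>] assms by simp

lemma scale_zero_right [simp]: "c \<odot> \<zero> = \<zero>"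
  using scale_scale[of \<zero> c 0] by simp

lemma mult_zero_left [simp]: "x \<in> carrier A \<Longrightarrow> \<zero> \<cdot> x = \<zero>"
  using scale_mult_left[of \<zero> x 0] by simp

lemma mult_zero_right [simp]: "x \<in> carrier A \<Longrightarrow> x \<cdot> \<zero> = \<zero>"
  using scale_mult_right[of x \<zero> 0] by simp

lemma minus_closed [simp]: "\<lbrakk>x \<in> carrier A; y \<in> carrier A\<rbrakk> \<Longrightarrow> x \<ominus> y \<in> carrier A"
  by (simp add: cminus_def)

lemma minus_self [simp]: "x \<in> carrier A \<Longrightarrow> x \<ominus> x = \<zero>"
  using scale_add_left[of x 1 "-1"] by (simp add: cminus_def scale_one)

lemma scale_minus: "\<lbrakk>x \<in> carrier A; y \<in> carrier A\<rbrakk> \<Longrightarrow> c \<odot> (x \<ominus> y) = c \<odot> x \<ominus> c \<odot> y"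
  by (simp add: cminus_def scale_add_right scale_scale)

lemma scale_diff: "x \<in> carrier A \<Longrightarrow> (c - d) \<odot> x = c \<odot> x \<ominus> d \<odot> x"
  using scale_add_left[of x c "-d"] by (simp add: cminus_def scale_scale)

lemma mult_minus:
  "\<lbrakk>x \<in> carrier A; y \<in> carrier A; z \<in> carrier A\<rbrakk> \<Longrightarrow> x \<cdot> (y \<ominus> z) = x \<cdot> y \<ominus> x \<cdot> z"
  by (simp add: cminus_def distrib_left scale_mult_right)

lemma minus_mult:
  "\<lbrakk>x \<in> carrier A; y \<in> carrier A; z \<in> carrier A\<rbrakk> \<Longrightarrow> (x \<ominus> y) \<cdot> z = x \<cdot> z \<ominus> y \<cdot> z"
  by (simp add: cminus_def distrib_right scale_mult_left)

lemma adj_minus: "\<lbrakk>x \<in> carrier A; y \<in> carrier A\<rbrakk> \<Longrightarrow> (x \<ominus> y)\<^sup>\<star> = x\<^sup>\<star> \<ominus> y\<^sup>\<star>"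
  by (simp add: cminus_def adj_add adj_scale)

lemma minus_add_add:
  assumes "x \<in> carrier A" "y \<in> carrier A" "z \<in> carrier A" "w \<in> carrier A"
  shows "(x \<oplus> y) \<ominus> (z \<oplus> w) = (x \<ominus> z) \<oplus> (y \<ominus> w)"
  using assms by (simp add: cminus_def scale_add_right add_ac)

text \<open>Regrouping isolates \<open>y \<ominus> y\<close>, which vanishes. This telescoping is
  what the triangle inequality for \<open>cdist\<close> rests on.\<close>

lemma minus_add_minus:
  assumes "x \<in> carrier A" "y \<in> carrier A" "z \<in> carrier A"
  shows "(x \<ominus> y) \<oplus> (y \<ominus> z) = x \<ominus> z"
proof -
  have "(x \<ominus> y) \<oplus> (y \<ominus> z) = (x \<ominus> z) \<oplus> (y \<ominus> y)"
    using assms unfolding cminus_def by (simp add: add_ac)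
  then show ?thesis
    using assms by simp
qed

section \<open>The norm and its metric\<close>

lemma norm_zero [simp]: "\<parallel>\<zero>\<parallel> = 0"
  by (simp add: norm_eq_zero)

text \<open>The C*-identity and submultiplicativity bound the square of the norm of \<open>y\<close>
  by the product of the norms of its adjoint and of \<open>y\<close>. Cancelling gives one
  inequality, and the same bound for the adjoint gives the other.\<close>

lemma norm_adj [simp]:
  assumes "x \<in> carrier A" shows "\<parallel>x\<^sup>\<star>\<parallel> = \<parallel>x\<parallel>"
proof -
  have le: "\<parallel>y\<parallel> \<le> \<parallel>y\<^sup>\<star>\<parallel>" if y: "y \<in> carrier A" for y
  proof (cases "\<parallel>y\<parallel> = 0")
    case False
    have "\<parallel>y\<parallel> * \<parallel>y\<parallel> \<le> \<parallel>y\<^sup>\<star>\<parallel> * \<parallel>y\<parallel>"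
      using norm_mult[of "y\<^sup>\<star>" y] norm_cstar[OF y] y by (simp add: power2_eq_square)
    then show ?thesis
      using False norm_nonneg[OF y] by simp
  qed (simp add: y norm_nonneg)
  show ?thesis
    using le[OF assms] le[of "x\<^sup>\<star>"] assms by (simp add: adj_adj)
qed

lemma cdist_eq: "\<lbrakk>x \<in> carrier A; y \<in> carrier A\<rbrakk> \<Longrightarrow> cdist A x y = \<parallel>x \<ominus> y\<parallel>"
  by (simp add: cdist_def)

lemma cdist_triangle:
  assumes "x \<in> carrier A" "y \<in> carrier A" "z \<in> carrier A"
  shows "cdist A x z \<le> cdist A x y + cdist A y z"
  using norm_triangle[of "x \<ominus> y" "y \<ominus> z"] assms by (simp add: cdist_eq minus_add_minus)

lemma cdist_commute: "cdist A x y = cdist A y x"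
proof (cases "x \<in> carrier A \<and> y \<in> carrier A")
  case True
  then have "y \<ominus> x = (-1) \<odot> (x \<ominus> y)"
    by (simp add: cminus_def scale_add_right scale_scale scale_one add_comm)
  then have "\<parallel>y \<ominus> x\<parallel> = \<parallel>x \<ominus> y\<parallel>"
    using True by (simp add: norm_scale)
  then show ?thesis
    using True by (simp add: cdist_eq)
qed (auto simp: cdist_def)

lemma cdist_self [simp]: "cdist A x x = 0"
  by (simp add: cdist_def)

lemma cdist_add:
  assumes "x \<in> carrier A" "y \<in> carrier A" "z \<in> carrier A" "w \<in> carrier A"
  shows "cdist A (x \<oplus> y) (z \<oplus> w) \<le> cdist A x z + cdist A y w"
  using norm_triangle[of "x \<ominus> z" "y \<ominus> w"] assms by (simp add: cdist_eq minus_add_add)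

lemma cdist_scale:
  assumes "x \<in> carrier A" "y \<in> carrier A"
  shows "cdist A (c \<odot> x) (c \<odot> y) = cmod c * cdist A x y"
  using assms by (simp add: cdist_eq norm_scale flip: scale_minus)

lemma cdist_scale_scale:
  assumes "x \<in> carrier A"
  shows "cdist A (c \<odot> x) (d \<odot> x) = cmod (c - d) * \<parallel>x\<parallel>"
  using assms by (simp add: cdist_eq norm_scale flip: scale_diff)

lemma cdist_mult_left:
  assumes "a \<in> carrier A" "x \<in> carrier A" "y \<in> carrier A"
  shows "cdist A (a \<cdot> x) (a \<cdot> y) \<le> \<parallel>a\<parallel> * cdist A x y"
  using assms norm_mult[of a "x \<ominus> y"] by (simp add: cdist_eq flip: mult_minus)

lemma cdist_mult_right:
  assumes "a \<in> carrier A" "x \<in> carrier A" "y \<in> carrier A"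
  shows "cdist A (x \<cdot> a) (y \<cdot> a) \<le> cdist A x y * \<parallel>a\<parallel>"
  using assms norm_mult[of "x \<ominus> y" a] by (simp add: cdist_eq flip: minus_mult)

lemma cdist_adj: "\<lbrakk>x \<in> carrier A; y \<in> carrier A\<rbrakk> \<Longrightarrow> cdist A (x\<^sup>\<star>) (y\<^sup>\<star>) = cdist A x y"
  by (simp add: cdist_eq flip: adj_minus)

sublocale norm: Metric_space "carrier A" "cdist A"
proof
  fix x y z
  show "0 \<le> cdist A x y"
    by (simp add: cdist_def norm_nonneg)
  show "cdist A x y = cdist A y x"
    by (rule cdist_commute)
  show "cdist A x z \<le> cdist A x y + cdist A y z"
    if "x \<in> carrier A" "y \<in> carrier A" "z \<in> carrier A"
    using that by (rule cdist_triangle)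
  show "cdist A x y = 0 \<longleftrightarrow> x = y" if xy: "x \<in> carrier A" "y \<in> carrier A"
  proof
    assume "cdist A x y = 0"
    then have "x \<ominus> y = \<zero>"
      using xy by (simp add: cdist_eq norm_eq_zero)
    then show "x = y"
      \<comment> \<open>Since \<open>x \<ominus> y\<close> vanishes, telescoping towards the third
        point \<open>\<zero>\<close> leaves \<open>y = x\<close>.\<close>
      using minus_add_minus[of x y \<zero>] xy by (simp add: cminus_def)
  qed simp
qed

text \<open>A point outside \<open>D\<close> must fail the approximation condition for some radius,
  and the ball of that radius then avoids \<open>D\<close>.\<close>

lemma closedin_norm_topologyI:
  assumes "D \<subseteq> carrier A"
    and "\<And>x. \<lbrakk>x \<in> carrier A; \<And>\<epsilon>. 0 < \<epsilon> \<Longrightarrow> \<exists>y\<in>D. cdist A x y < \<epsilon>\<rbrakk> \<Longrightarrow> x \<in> D"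
  shows "closedin (norm_topology A) D"
  unfolding norm_topology_def closedin_def norm.topspace_mtopology norm.openin_mtopology
proof (intro conjI allI impI)
  fix x assume "x \<in> carrier A - D"
  then obtain \<epsilon> where "0 < \<epsilon>" "\<forall>y\<in>D. \<not> cdist A x y < \<epsilon>"
    using assms(2) by blast
  then show "\<exists>r>0. norm.mball x r \<subseteq> carrier A - D"
    by (intro exI[of _ \<epsilon>]) (auto simp: norm.in_mball)
qed (use assms(1) in auto)

lemma continuous_map_normD:
  assumes "continuous_map X (norm_topology A) f" "p \<in> topspace X" "0 < \<epsilon>"
  obtains U where "openin X U" "p \<in> U" "\<And>q. q \<in> U \<Longrightarrow> cdist A (f p) (f q) < \<epsilon>"
proof
  have "f p \<in> carrier A"
    using assms(1,2) by (auto simp: continuous_map_def norm_topology_def)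
  moreover show "openin X {q \<in> topspace X. f q \<in> norm.mball (f p) \<epsilon>}"
    using assms(1) norm.openin_mball unfolding norm_topology_def
    by (rule openin_continuous_map_preimage)
  ultimately show "p \<in> {q \<in> topspace X. f q \<in> norm.mball (f p) \<epsilon>}"
    using assms(2,3) by simp
qed simp

section \<open>Finite sums\<close>

lemma csum_empty [simp]: "csum A f {} = \<zero>"
  and csum_closed [simp]: "(\<And>i. i \<in> I \<Longrightarrow> f i \<in> carrier A) \<Longrightarrow> csum A f I \<in> carrier A"
  and csum_insert [simp]:
    "\<lbrakk>finite I; j \<notin> I; f j \<in> carrier A; \<And>i. i \<in> I \<Longrightarrow> f i \<in> carrier A\<rbrakk>
      \<Longrightarrow> csum A f (insert j I) = f j \<oplus> csum A f I"
proof -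
  interpret comm_group "add_group A"
    by (rule add_comm_group)
  show "csum A f {} = \<zero>"
    "(\<And>i. i \<in> I \<Longrightarrow> f i \<in> carrier A) \<Longrightarrow> csum A f I \<in> carrier A"
    "\<lbrakk>finite I; j \<notin> I; f j \<in> carrier A; \<And>i. i \<in> I \<Longrightarrow> f i \<in> carrier A\<rbrakk>
      \<Longrightarrow> csum A f (insert j I) = f j \<oplus> csum A f I"
    using finprod_empty[of f] finprod_closed[of f I] finprod_insert[of I j f]
    by (auto simp: csum_def add_group_def)
qed

lemma csum_cong:
  assumes "\<And>i. i \<in> I \<Longrightarrow> f i = g i" "\<And>i. i \<in> I \<Longrightarrow> g i \<in> carrier A"
  shows "csum A f I = csum A g I"
proof -
  interpret comm_group "add_group A"
    by (rule add_comm_group)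
  show ?thesis
    unfolding csum_def using assms by (intro finprod_cong') (auto simp: add_group_def)
qed

lemma mult_csum:
  assumes "finite I" "a \<in> carrier A" "\<And>i. i \<in> I \<Longrightarrow> f i \<in> carrier A"
  shows "a \<cdot> csum A f I = csum A (\<lambda>i. a \<cdot> f i) I"
  using assms by (induction I) (auto simp: distrib_left)

lemma csum_mult:
  assumes "finite I" "a \<in> carrier A" "\<And>i. i \<in> I \<Longrightarrow> f i \<in> carrier A"
  shows "csum A f I \<cdot> a = csum A (\<lambda>i. f i \<cdot> a) I"
  using assms by (induction I) (auto simp: distrib_right)

lemma scale_csum:
  assumes "finite I" "\<And>i. i \<in> I \<Longrightarrow> f i \<in> carrier A"
  shows "c \<odot> csum A f I = csum A (\<lambda>i. c \<odot> f i) I"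
  using assms by (induction I) (auto simp: scale_add_right)

lemma csum_scale_left:
  assumes "finite I" "a \<in> carrier A"
  shows "csum A (\<lambda>i. c i \<odot> a) I = (\<Sum>i\<in>I. c i) \<odot> a"
  using assms by (induction I) (auto simp: scale_add_left)

text \<open>The vanishing terms are rewritten as \<open>0 \<odot> \<zero>\<close>, so that
  \<open>csum_scale_left\<close> evaluates their sum.\<close>

lemma csum_single:
  assumes "finite I" "j \<in> I" "f j \<in> carrier A" "\<And>i. \<lbrakk>i \<in> I; i \<noteq> j\<rbrakk> \<Longrightarrow> f i = \<zero>"
  shows "csum A f I = f j"
proof -
  have "csum A f (I - {j}) = csum A (\<lambda>i. 0 \<odot> \<zero>) (I - {j})"
    using assms by (intro csum_cong) auto
  also have "\<dots> = \<zero>"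
    using assms(1) by (subst csum_scale_left) auto
  finally have "csum A f (insert j (I - {j})) = f j"
    using assms by (subst csum_insert; force)
  then show ?thesis
    using assms(2) by (simp add: insert_absorb)
qed

lemma cdist_csum:
  assumes "finite I" "\<And>i. i \<in> I \<Longrightarrow> f i \<in> carrier A" "\<And>i. i \<in> I \<Longrightarrow> g i \<in> carrier A"
  shows "cdist A (csum A f I) (csum A g I) \<le> (\<Sum>i\<in>I. cdist A (f i) (g i))"
  using assms
proof (induction I)
  case (insert j I)
  then show ?case
    using cdist_add[of "f j" "csum A f I" "g j" "csum A g I"] by simp
qed simp

text \<open>Elements of the Ellwood range are sums over initial segments of the natural numbers;
  this splitting makes it possible to add two of them by concatenation.\<close>

lemma csum_append:
  fixes n m :: nat
  assumes "\<And>i. i < n + m \<Longrightarrow> f i \<in> carrier A"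
  shows "csum A f {..<n + m} = csum A f {..<n} \<oplus> csum A (\<lambda>i. f (n + i)) {..<m}"
  using assms
proof (induction m)
  case (Suc m)
  then have "csum A f {..<n + Suc m} = f (n + m) \<oplus> (csum A f {..<n} \<oplus> csum A (\<lambda>i. f (n + i)) {..<m})"
    unfolding add_Suc_right lessThan_Suc by (subst csum_insert) (auto intro!: csum_closed)
  also have "\<dots> = csum A f {..<n} \<oplus> (f (n + m) \<oplus> csum A (\<lambda>i. f (n + i)) {..<m})"
    using Suc.prems by (intro add_left_comm) (auto intro!: csum_closed)
  also have "f (n + m) \<oplus> csum A (\<lambda>i. f (n + i)) {..<m} = csum A (\<lambda>i. f (n + i)) {..<Suc m}"
    using Suc.prems unfolding lessThan_Suc by (intro csum_insert[symmetric]) auto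
  finally show ?case .
qed (simp, subst add_zero_right, auto intro!: csum_closed)

end

section \<open>Approximation by elements of the Ellwood range\<close>

locale cstar_dynamical_system = cstar_algebra A
  for A :: "('a, 'm) cstar_scheme" (structure) +
  fixes G :: "('g, 'k) monoid_scheme" and X :: "'g topology" and \<alpha> :: "'g \<Rightarrow> 'a \<Rightarrow> 'a"
  assumes action: "cstar_action G X A \<alpha>"
begin

lemma action_star_hom: "g \<in> topspace X \<Longrightarrow> star_hom A A (\<alpha> g)"
  using action compact_group.topspace[of G X] by (auto simp: cstar_action_def star_aut_def)

lemma action_closed [simp]: "\<lbrakk>g \<in> topspace X; x \<in> carrier A\<rbrakk> \<Longrightarrow> \<alpha> g x \<in> carrier A"
  using action_star_hom[of g] by (auto simp: star_hom_def)

lemma action_mult: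
  "\<lbrakk>g \<in> topspace X; x \<in> carrier A; y \<in> carrier A\<rbrakk> \<Longrightarrow> \<alpha> g (x \<cdot> y) = \<alpha> g x \<cdot> \<alpha> g y"
  using action_star_hom[of g] by (simp add: star_hom_def)

lemma action_adj: "\<lbrakk>g \<in> topspace X; x \<in> carrier A\<rbrakk> \<Longrightarrow> \<alpha> g (x\<^sup>\<star>) = (\<alpha> g x)\<^sup>\<star>"
  using action_star_hom[of g] by (simp add: star_hom_def)

section \<open>Algebraic operations on the Ellwood range\<close>

lemma ellwood_rangeI:
  fixes n :: nat
  assumes "\<And>i. i < n \<Longrightarrow> x i \<in> carrier A" "\<And>i. i < n \<Longrightarrow> y i \<in> carrier A"
  shows "(\<lambda>g\<in>topspace X. csum A (\<lambda>i. x i \<cdot> \<alpha> g (y i)) {..<n}) \<in> ellwood_range X A \<alpha>"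
  unfolding ellwood_range_def
  by (rule CollectI, rule exI[of _ x], rule exI[of _ y], rule exI[of _ n]) (simp add: assms)

lemma ellwood_rangeE:
  assumes "h \<in> ellwood_range X A \<alpha>"
  obtains n :: nat and x y where "\<And>i. i < n \<Longrightarrow> x i \<in> carrier A" "\<And>i. i < n \<Longrightarrow> y i \<in> carrier A"
    "\<And>g. g \<in> topspace X \<Longrightarrow> h g = csum A (\<lambda>i. x i \<cdot> \<alpha> g (y i)) {..<n}"
proof -
  obtain x y and n :: nat where "\<forall>i<n. x i \<in> carrier A \<and> y i \<in> carrier A"
    "h = (\<lambda>g\<in>topspace X. csum A (\<lambda>i. x i \<cdot> \<alpha> g (y i)) {..<n})"
    using assms unfolding ellwood_range_def by blast
  then show thesis
    by (intro that[of n x y]) simp_all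
qed

lemma ellwood_range_closed:
  assumes "h \<in> ellwood_range X A \<alpha>" "g \<in> topspace X"
  shows "h g \<in> carrier A"
  using assms(1) by (rule ellwood_rangeE) (auto simp: assms(2) intro!: csum_closed)

text \<open>The factor \<open>a\<close> is absorbed into the left legs \<open>x i\<close> of the
  tensors, which the action does not touch.\<close>

lemma ellwood_range_mult:
  assumes "a \<in> carrier A" "h \<in> ellwood_range X A \<alpha>"
  shows "\<exists>k\<in>ellwood_range X A \<alpha>. \<forall>g\<in>topspace X. k g = a \<cdot> h g"
  using assms(2)
proof (rule ellwood_rangeE)
  fix n :: nat and x y
  assume *: "\<And>i. i < n \<Longrightarrow> x i \<in> carrier A" "\<And>i. i < n \<Longrightarrow> y i \<in> carrier A"
    "\<And>g. g \<in> topspace X \<Longrightarrow> h g = csum A (\<lambda>i. x i \<cdot> \<alpha> g (y i)) {..<n}"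
  show ?thesis
  proof (intro bexI ballI)
    show "(\<lambda>g\<in>topspace X. csum A (\<lambda>i. (a \<cdot> x i) \<cdot> \<alpha> g (y i)) {..<n}) \<in> ellwood_range X A \<alpha>"
      using assms(1) * by (intro ellwood_rangeI) auto
  next
    fix g assume g: "g \<in> topspace X"
    show "(\<lambda>g\<in>topspace X. csum A (\<lambda>i. (a \<cdot> x i) \<cdot> \<alpha> g (y i)) {..<n}) g = a \<cdot> h g"
      using g assms(1) * unfolding *(3)[OF g] by (subst mult_csum)
        (auto simp: mult_assoc intro!: csum_cong)
  qed
qed

text \<open>The factor \<open>b\<close> is absorbed into the right legs:
  \<open>\<alpha> g (y i \<cdot> b)\<close> equals
  \<open>\<xi> g \<odot> (\<alpha> g (y i) \<cdot> b)\<close>. The price is the character-like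
  factor \<open>\<xi>\<close>, and this is how the twist changes later.\<close>

lemma ellwood_range_mult_eigen:
  assumes "b \<in> carrier A" "\<And>g. g \<in> topspace X \<Longrightarrow> \<alpha> g b = \<xi> g \<odot> b" "h \<in> ellwood_range X A \<alpha>"
  shows "\<exists>k\<in>ellwood_range X A \<alpha>. \<forall>g\<in>topspace X. k g = \<xi> g \<odot> (h g \<cdot> b)"
  using assms(3)
proof (rule ellwood_rangeE)
  fix n :: nat and x y
  assume *: "\<And>i. i < n \<Longrightarrow> x i \<in> carrier A" "\<And>i. i < n \<Longrightarrow> y i \<in> carrier A"
    "\<And>g. g \<in> topspace X \<Longrightarrow> h g = csum A (\<lambda>i. x i \<cdot> \<alpha> g (y i)) {..<n}"
  let ?k = "\<lambda>g\<in>topspace X. csum A (\<lambda>i. x i \<cdot> \<alpha> g (y i \<cdot> b)) {..<n}"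
  have "?k g = \<xi> g \<odot> (h g \<cdot> b)" if g: "g \<in> topspace X" for g
  proof -
    have "x i \<cdot> \<alpha> g (y i \<cdot> b) = (x i \<cdot> \<alpha> g (y i)) \<cdot> (\<xi> g \<odot> b)" if "i \<in> {..<n}" for i
      using that g assms(1,2) * by (simp add: action_mult mult_assoc)
    then have "?k g = csum A (\<lambda>i. (x i \<cdot> \<alpha> g (y i)) \<cdot> (\<xi> g \<odot> b)) {..<n}"
      using g assms(1) * by (auto intro!: csum_cong)
    also have "\<dots> = h g \<cdot> (\<xi> g \<odot> b)"
      using g assms(1) * unfolding *(3)[OF g] by (subst csum_mult) auto
    also have "\<dots> = \<xi> g \<odot> (h g \<cdot> b)"
      using g assms ellwood_range_closed by (simp add: scale_mult_right)
    finally show ?thesis .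
  qed
  moreover have "?k \<in> ellwood_range X A \<alpha>"
    using assms(1) * by (intro ellwood_rangeI) auto
  ultimately show ?thesis
    by blast
qed

lemma ellwood_range_scale:
  assumes "h \<in> ellwood_range X A \<alpha>"
  shows "\<exists>k\<in>ellwood_range X A \<alpha>. \<forall>g\<in>topspace X. k g = c \<odot> h g"
  using assms
proof (rule ellwood_rangeE)
  fix n :: nat and x y
  assume *: "\<And>i. i < n \<Longrightarrow> x i \<in> carrier A" "\<And>i. i < n \<Longrightarrow> y i \<in> carrier A"
    "\<And>g. g \<in> topspace X \<Longrightarrow> h g = csum A (\<lambda>i. x i \<cdot> \<alpha> g (y i)) {..<n}"
  show ?thesis
  proof (intro bexI ballI)
    show "(\<lambda>g\<in>topspace X. csum A (\<lambda>i. (c \<odot> x i) \<cdot> \<alpha> g (y i)) {..<n}) \<in> ellwood_range X A \<alpha>"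
      using * by (intro ellwood_rangeI) auto
  next
    fix g assume g: "g \<in> topspace X"
    show "(\<lambda>g\<in>topspace X. csum A (\<lambda>i. (c \<odot> x i) \<cdot> \<alpha> g (y i)) {..<n}) g = c \<odot> h g"
      using g * unfolding *(3)[OF g] by (subst scale_csum)
        (auto simp: scale_mult_left intro!: csum_cong)
  qed
qed

lemma ellwood_range_add:
  assumes "h \<in> ellwood_range X A \<alpha>" "h' \<in> ellwood_range X A \<alpha>"
  shows "\<exists>k\<in>ellwood_range X A \<alpha>. \<forall>g\<in>topspace X. k g = h g \<oplus> h' g"
proof -
  obtain n :: nat and x y where *: "\<And>i. i < n \<Longrightarrow> x i \<in> carrier A" "\<And>i. i < n \<Longrightarrow> y i \<in> carrier A"
    "\<And>g. g \<in> topspace X \<Longrightarrow> h g = csum A (\<lambda>i. x i \<cdot> \<alpha> g (y i)) {..<n}"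
    using assms(1) by (rule ellwood_rangeE) blast
  obtain m :: nat and z w where **: "\<And>i. i < m \<Longrightarrow> z i \<in> carrier A" "\<And>i. i < m \<Longrightarrow> w i \<in> carrier A"
    "\<And>g. g \<in> topspace X \<Longrightarrow> h' g = csum A (\<lambda>i. z i \<cdot> \<alpha> g (w i)) {..<m}"
    using assms(2) by (rule ellwood_rangeE) blast
  \<comment> \<open>The two lists of elementary tensors are concatenated, the second one shifted by
    \<open>n\<close>.\<close>
  let ?x = "\<lambda>i. if i < n then x i else z (i - n)" and ?y = "\<lambda>i. if i < n then y i else w (i - n)"
  show ?thesis
  proof (intro bexI ballI)
    show "(\<lambda>g\<in>topspace X. csum A (\<lambda>i. ?x i \<cdot> \<alpha> g (?y i)) {..<n + m}) \<in> ellwood_range X A \<alpha>"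
      by (rule ellwood_rangeI) (simp_all add: * **)
    fix g assume g: "g \<in> topspace X"
    have "csum A (\<lambda>i. ?x i \<cdot> \<alpha> g (?y i)) {..<n + m} =
      csum A (\<lambda>i. ?x i \<cdot> \<alpha> g (?y i)) {..<n} \<oplus> csum A (\<lambda>i. ?x (n + i) \<cdot> \<alpha> g (?y (n + i))) {..<m}"
      by (rule csum_append) (simp add: * ** g)
    also have "csum A (\<lambda>i. ?x i \<cdot> \<alpha> g (?y i)) {..<n} = h g"
      unfolding *(3)[OF g] by (rule csum_cong) (simp_all add: * g)
    also have "csum A (\<lambda>i. ?x (n + i) \<cdot> \<alpha> g (?y (n + i))) {..<m} = h' g"
      unfolding **(3)[OF g] by (rule csum_cong) (simp_all add: ** g)
    finally show "(\<lambda>g\<in>topspace X. csum A (\<lambda>i. ?x i \<cdot> \<alpha> g (?y i)) {..<n + m}) g = h g \<oplus> h' g"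
      using g by simp
  qed
qed

text \<open>This is membership in the uniform closure of the range, phrased for arbitrary functions
  whose values off the space are irrelevant. That permits plain lambda terms instead of extensional
  functions.\<close>

definition approximable :: "('g \<Rightarrow> 'a) \<Rightarrow> bool" where
  "approximable F \<longleftrightarrow> F \<in> topspace X \<rightarrow> carrier A \<and>
     (\<forall>\<epsilon>>0. \<exists>h\<in>ellwood_range X A \<alpha>. \<forall>g\<in>topspace X. cdist A (F g) (h g) < \<epsilon>)"

lemma approximable_closed: "\<lbrakk>approximable F; g \<in> topspace X\<rbrakk> \<Longrightarrow> F g \<in> carrier A"
  by (auto simp: approximable_def)

lemma approximable_cong:
  "(\<And>g. g \<in> topspace X \<Longrightarrow> F g = F' g) \<Longrightarrow> approximable F \<longleftrightarrow> approximable F'"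
  unfolding approximable_def Pi_iff by (simp cong: ball_cong)

lemma approximable_ellwood_range:
  "h \<in> ellwood_range X A \<alpha> \<Longrightarrow> approximable h"
  unfolding approximable_def using ellwood_range_closed by (intro conjI allI impI bexI[of _ h]) auto

lemma approximable_elementary:
  assumes "x \<in> carrier A" "y \<in> carrier A"
  shows "approximable (\<lambda>g. x \<cdot> \<alpha> g y)"
proof -
  have "approximable (\<lambda>g\<in>topspace X. csum A (\<lambda>i. x \<cdot> \<alpha> g y) {..<Suc 0})"
    using assms by (intro approximable_ellwood_range ellwood_rangeI)
  then show ?thesis
    by (rule approximable_cong[THEN iffD1, rotated]) (simp add: assms lessThan_Suc)
qed

lemma approximable_zero: "approximable (\<lambda>g. \<zero>)"
proof -
  have "approximable (\<lambda>g. \<zero> \<cdot> \<alpha> g \<zero>)"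
    by (intro approximable_elementary) auto
  then show ?thesis
    by (rule approximable_cong[THEN iffD1, rotated]) simp
qed

text \<open>Taking the uniform closure twice adds nothing, by splitting \<open>\<epsilon>\<close>
  into halves.\<close>

lemma approximable_limit:
  assumes "\<And>g. g \<in> topspace X \<Longrightarrow> F g \<in> carrier A"
    and "\<And>\<epsilon>. 0 < \<epsilon> \<Longrightarrow> \<exists>F'. approximable F' \<and> (\<forall>g\<in>topspace X. cdist A (F g) (F' g) < \<epsilon>)"
  shows "approximable F"
  unfolding approximable_def
proof (intro conjI allI impI)
  fix \<epsilon> :: real assume "0 < \<epsilon>"
  then obtain F' where F': "approximable F'" "\<forall>g\<in>topspace X. cdist A (F g) (F' g) < \<epsilon> / 2"
    using assms(2)[of "\<epsilon> / 2"] by auto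
  then obtain h where h: "h \<in> ellwood_range X A \<alpha>" "\<forall>g\<in>topspace X. cdist A (F' g) (h g) < \<epsilon> / 2"
    using half_gt_zero[OF \<open>0 < \<epsilon>\<close>] unfolding approximable_def by blast
  have "cdist A (F g) (h g) < \<epsilon>" if g: "g \<in> topspace X" for g
  proof -
    have "cdist A (F g) (h g) \<le> cdist A (F g) (F' g) + cdist A (F' g) (h g)"
      using g by (intro cdist_triangle assms(1) approximable_closed[OF F'(1)] ellwood_range_closed[OF h(1)])
    also have "\<dots> < \<epsilon> / 2 + \<epsilon> / 2"
      using F'(2) h(2) g by (intro add_strict_mono) auto
    finally show ?thesis
      by simp
  qed
  then show "\<exists>h\<in>ellwood_range X A \<alpha>. \<forall>g\<in>topspace X. cdist A (F g) (h g) < \<epsilon>"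
    using h(1) by blast
qed (use assms(1) in auto)

lemma approximable_add:
  assumes "approximable F" "approximable F'"
  shows "approximable (\<lambda>g. F g \<oplus> F' g)"
proof (rule approximable_limit)
  fix \<epsilon> :: real assume "0 < \<epsilon>"
  then have "0 < \<epsilon> / 2"
    by simp
  then obtain h h'
    where h: "h \<in> ellwood_range X A \<alpha>" "\<forall>g\<in>topspace X. cdist A (F g) (h g) < \<epsilon> / 2"
      and h': "h' \<in> ellwood_range X A \<alpha>" "\<forall>g\<in>topspace X. cdist A (F' g) (h' g) < \<epsilon> / 2"
    using assms unfolding approximable_def by blast
  obtain k where k: "k \<in> ellwood_range X A \<alpha>" "\<forall>g\<in>topspace X. k g = h g \<oplus> h' g"
    using ellwood_range_add[OF h(1) h'(1)] by blast
  have "cdist A (F g \<oplus> F' g) (k g) < \<epsilon>" if g: "g \<in> topspace X" for g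
  proof -
    have "cdist A (F g \<oplus> F' g) (k g) \<le> cdist A (F g) (h g) + cdist A (F' g) (h' g)"
      unfolding bspec[OF k(2) g] using g
      by (intro cdist_add approximable_closed[OF assms(1)] approximable_closed[OF assms(2)]
          ellwood_range_closed[OF h(1)] ellwood_range_closed[OF h'(1)])
    also have "\<dots> < \<epsilon> / 2 + \<epsilon> / 2"
      using h(2) h'(2) g by (intro add_strict_mono) auto
    finally show ?thesis
      by simp
  qed
  then show "\<exists>H. approximable H \<and> (\<forall>g\<in>topspace X. cdist A (F g \<oplus> F' g) (H g) < \<epsilon>)"
    using k(1) approximable_ellwood_range by blast
qed (simp add: assms approximable_closed)

lemma approximable_csum:
  assumes "finite I" "\<And>i. i \<in> I \<Longrightarrow> approximable (F i)"
  shows "approximable (\<lambda>g. csum A (\<lambda>i. F i g) I)"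
  using assms
proof (induction I)
  case (insert j I)
  then have "approximable (\<lambda>g. F j g \<oplus> csum A (\<lambda>i. F i g) I)"
    by (simp add: approximable_add)
  then show ?case
    by (rule approximable_cong[THEN iffD1, rotated]) (use insert in \<open>simp add: approximable_closed\<close>)
qed (simp add: approximable_zero)

text \<open>An operation that preserves the range and is Lipschitz at each point, with a common
  constant, preserves its uniform closure. Scaling, left multiplication and right multiplication by
  eigenvectors are all instances.\<close>

lemma approximable_transfer:
  assumes "approximable F" "0 \<le> C" "\<And>g. g \<in> topspace X \<Longrightarrow> F' g \<in> carrier A"
    and "\<And>h. h \<in> ellwood_range X A \<alpha> \<Longrightarrow>
      \<exists>k\<in>ellwood_range X A \<alpha>. \<forall>g\<in>topspace X. cdist A (F' g) (k g) \<le> C * cdist A (F g) (h g)"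
  shows "approximable F'"
  unfolding approximable_def
proof (intro conjI allI impI)
  fix \<epsilon> :: real assume "0 < \<epsilon>"
  \<comment> \<open>The summand 1 covers the case \<open>C = 0\<close> and makes the final estimate
    strict.\<close>
  then have "0 < \<epsilon> / (C + 1)"
    using assms(2) by simp
  then obtain h
    where h: "h \<in> ellwood_range X A \<alpha>" "\<forall>g\<in>topspace X. cdist A (F g) (h g) < \<epsilon> / (C + 1)"
    using assms(1) unfolding approximable_def by blast
  obtain k where k: "k \<in> ellwood_range X A \<alpha>"
    "\<forall>g\<in>topspace X. cdist A (F' g) (k g) \<le> C * cdist A (F g) (h g)"
    using assms(4)[OF h(1)] by blast
  have "cdist A (F' g) (k g) < \<epsilon>" if g: "g \<in> topspace X" for g
  proof -
    have "cdist A (F' g) (k g) \<le> C * (\<epsilon> / (C + 1))"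
      using k(2) h(2) g assms(2) by (meson less_imp_le mult_left_mono order_trans)
    also have "\<dots> < \<epsilon>"
      using \<open>0 < \<epsilon>\<close> assms(2) by (simp add: field_simps)
    finally show ?thesis .
  qed
  then show "\<exists>h\<in>ellwood_range X A \<alpha>. \<forall>g\<in>topspace X. cdist A (F' g) (h g) < \<epsilon>"
    using k(1) by blast
qed (use assms(3) in auto)

lemma approximable_scale:
  assumes "approximable F"
  shows "approximable (\<lambda>g. c \<odot> F g)"
proof (rule approximable_transfer[where C = "cmod c"])
  fix h assume h: "h \<in> ellwood_range X A \<alpha>"
  then obtain k where "k \<in> ellwood_range X A \<alpha>" "\<forall>g\<in>topspace X. k g = c \<odot> h g"
    using ellwood_range_scale by blast
  then show "\<exists>k\<in>ellwood_range X A \<alpha>.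
      \<forall>g\<in>topspace X. cdist A (c \<odot> F g) (k g) \<le> cmod c * cdist A (F g) (h g)"
    using assms h by (intro bexI[of _ k]) (simp_all add: cdist_scale approximable_closed ellwood_range_closed)
qed (use assms approximable_closed in simp_all)

lemma approximable_mult:
  assumes "a \<in> carrier A" "approximable F"
  shows "approximable (\<lambda>g. a \<cdot> F g)"
proof (rule approximable_transfer[where C = "\<parallel>a\<parallel>"])
  fix h assume h: "h \<in> ellwood_range X A \<alpha>"
  then obtain k where "k \<in> ellwood_range X A \<alpha>" "\<forall>g\<in>topspace X. k g = a \<cdot> h g"
    using ellwood_range_mult assms by blast
  then show "\<exists>k\<in>ellwood_range X A \<alpha>.
      \<forall>g\<in>topspace X. cdist A (a \<cdot> F g) (k g) \<le> \<parallel>a\<parallel> * cdist A (F g) (h g)"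
    using assms h by (intro bexI[of _ k]) (simp_all add: cdist_mult_left approximable_closed ellwood_range_closed)
qed (use assms in \<open>simp_all add: approximable_closed norm_nonneg\<close>)

text \<open>As \<open>\<xi> g\<close> has modulus 1, the scalar does not affect distances, and the
  norm of \<open>b\<close> serves as Lipschitz constant.\<close>

lemma approximable_mult_eigen:
  assumes "approximable F" "b \<in> carrier A" "\<And>g. g \<in> topspace X \<Longrightarrow> \<alpha> g b = \<xi> g \<odot> b"
    and "\<And>g. g \<in> topspace X \<Longrightarrow> cmod (\<xi> g) = 1"
  shows "approximable (\<lambda>g. \<xi> g \<odot> (F g \<cdot> b))"
proof (rule approximable_transfer[where C = "\<parallel>b\<parallel>"])
  fix h assume h: "h \<in> ellwood_range X A \<alpha>"
  then obtain k where k: "k \<in> ellwood_range X A \<alpha>" "\<forall>g\<in>topspace X. k g = \<xi> g \<odot> (h g \<cdot> b)"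
    using ellwood_range_mult_eigen assms by blast
  have "cdist A (\<xi> g \<odot> (F g \<cdot> b)) (k g) \<le> \<parallel>b\<parallel> * cdist A (F g) (h g)" if "g \<in> topspace X" for g
    using assms h k(2) that cdist_mult_right[of b "F g" "h g"]
    by (simp add: cdist_scale approximable_closed ellwood_range_closed mult.commute)
  then show "\<exists>k\<in>ellwood_range X A \<alpha>.
      \<forall>g\<in>topspace X. cdist A (\<xi> g \<odot> (F g \<cdot> b)) (k g) \<le> \<parallel>b\<parallel> * cdist A (F g) (h g)"
    using k(1) by blast
qed (use assms in \<open>simp_all add: approximable_closed norm_nonneg\<close>)

end

section \<open>Circle actions\<close>

locale circle_dynamical_system = cstar_dynamical_system A circle_group circle_topology \<gamma>
  for A :: "('a, 'm) cstar_scheme" (structure) and \<gamma> :: "complex \<Rightarrow> 'a \<Rightarrow> 'a"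
begin

lemma topspace_circle [simp]: "topspace circle_topology = sphere 0 1"
  by (simp add: circle_topology_def)

lemma circle_power_int_add:
  "t \<in> sphere 0 1 \<Longrightarrow> (t :: complex) powi (m + n) = t powi m * t powi n"
  by (rule power_int_add) auto

lemma circle_inverse:
  assumes "t \<in> sphere 0 1" shows "inverse t = cnj t"
  using assms complex_norm_square[of t] by (intro inverse_unique) simp

section \<open>The twisted left ideals\<close>

definition twisted :: "int \<Rightarrow> 'a set" where
  "twisted n = {a \<in> carrier A. approximable (\<lambda>t. t powi n \<odot> a)}"

lemma twisted_closed: "a \<in> twisted n \<Longrightarrow> a \<in> carrier A"
  by (simp add: twisted_def)

text \<open>Powers of \<open>t\<close> have modulus 1 on the circle, so a close element
  \<open>b\<close> yields a function that is equally close, uniformly in \<open>t\<close>.\<close>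

lemma twisted_limit:
  assumes "a \<in> carrier A" "\<And>\<epsilon>. 0 < \<epsilon> \<Longrightarrow> \<exists>b\<in>twisted n. cdist A a b < \<epsilon>"
  shows "a \<in> twisted n"
proof -
  have "approximable (\<lambda>t. t powi n \<odot> a)"
  proof (rule approximable_limit)
    fix \<epsilon> :: real assume "0 < \<epsilon>"
    then obtain b where b: "b \<in> twisted n" "cdist A a b < \<epsilon>"
      using assms(2) by blast
    then show "\<exists>F. approximable F \<and>
        (\<forall>t\<in>topspace circle_topology. cdist A (t powi n \<odot> a) (F t) < \<epsilon>)"
      using assms(1)
      by (intro exI[of _ "\<lambda>t. t powi n \<odot> b"]) (simp add: twisted_def cdist_scale norm_power_int)
  qed (simp add: assms(1))
  then show ?thesis
    by (simp add: twisted_def assms(1))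
qed

lemma twisted_zero: "\<zero> \<in> twisted n"
  by (simp add: twisted_def approximable_zero)

lemma twisted_add:
  assumes "a \<in> twisted n" "b \<in> twisted n"
  shows "a \<oplus> b \<in> twisted n"
  using assms approximable_add[of "\<lambda>t. t powi n \<odot> a" "\<lambda>t. t powi n \<odot> b"]
  by (simp add: twisted_def scale_add_right)

lemma twisted_csum:
  assumes "finite I" "\<And>i. i \<in> I \<Longrightarrow> f i \<in> twisted n"
  shows "csum A f I \<in> twisted n"
  using assms
proof (induction I)
  case (insert j I)
  then show ?case
    using twisted_closed by (subst csum_insert) (auto intro!: twisted_add)
qed (simp add: twisted_zero)

lemma twisted_scale:
  assumes "a \<in> twisted n"
  shows "c \<odot> a \<in> twisted n"
  using assms approximable_scale[of "\<lambda>t. t powi n \<odot> a" c]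
  by (simp add: twisted_def scale_scale mult.commute)

lemma twisted_mult_left:
  assumes "a \<in> carrier A" "b \<in> twisted n"
  shows "a \<cdot> b \<in> twisted n"
  using assms approximable_mult[of a "\<lambda>t. t powi n \<odot> b"]
  by (simp add: twisted_def scale_mult_right)

text \<open>The eigenvalue \<open>t powi k\<close> of \<open>b\<close> multiplies the twist
  \<open>t powi n\<close> that \<open>a\<close> already carries, so degrees add.\<close>

lemma twisted_mult_eigen:
  assumes "a \<in> twisted n" "b \<in> carrier A" "\<And>t. t \<in> sphere 0 1 \<Longrightarrow> \<gamma> t b = t powi k \<odot> b"
  shows "a \<cdot> b \<in> twisted (n + k)"
proof -
  have "approximable (\<lambda>t. t powi k \<odot> ((t powi n \<odot> a) \<cdot> b))"
    using assms by (intro approximable_mult_eigen) (simp_all add: twisted_def norm_power_int)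
  then have "approximable (\<lambda>t. t powi (n + k) \<odot> (a \<cdot> b))"
    by (rule approximable_cong[THEN iffD1, rotated])
      (use assms(1,2) in \<open>simp add: twisted_def scale_mult_left scale_scale circle_power_int_add mult.commute\<close>)
  then show ?thesis
    using assms(1,2) by (simp add: twisted_def)
qed

section \<open>Multiplication by real polynomial functions on the circle\<close>

text \<open>
  Quantifying over all twists by powers of \<open>t\<close> makes this class of functions stable under
  multiplication by the coordinate functions, hence by all real polynomials in the real and
  imaginary parts of \<open>t\<close>.
\<close>

definition all_twists_approximable :: "(complex \<Rightarrow> 'a) \<Rightarrow> bool" where
  "all_twists_approximable F \<longleftrightarrow>
     F \<in> sphere 0 1 \<rightarrow> carrier A \<and> (\<forall>n. approximable (\<lambda>t. t powi n \<odot> F t))"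

lemma all_twists_approximable_closed:
  "\<lbrakk>all_twists_approximable F; t \<in> sphere 0 1\<rbrakk> \<Longrightarrow> F t \<in> carrier A"
  by (auto simp: all_twists_approximable_def)

text \<open>On the circle the conjugate of \<open>t\<close> is its inverse, so a real linear
  function is a combination of \<open>t\<close> and \<open>t powi (-1)\<close>. Multiplying by it
  combines the two neighbouring twists \<open>n + 1\<close> and \<open>n - 1\<close>.\<close>

lemma all_twists_approximable_linear:
  assumes p: "bounded_linear p" and F: "all_twists_approximable F"
  shows "all_twists_approximable (\<lambda>t. complex_of_real (p t) \<odot> F t)"
  unfolding all_twists_approximable_def
proof (intro conjI allI)
  \<comment> \<open>The coefficients come from inserting \<open>Re t = (t + cnj t) / 2\<close> and
    \<open>Im t = (t - cnj t) / (2 * \<i>)\<close> into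
    \<open>p t = Re t * p 1 + Im t * p \<i>\<close>.\<close>
  define c d where "c = (p 1 - \<i> * p \<i>) / 2" and "d = (p 1 + \<i> * p \<i>) / 2"
  have p_eq: "complex_of_real (p t) = c * t powi 1 + d * t powi (-1)" if t: "t \<in> sphere 0 1" for t
  proof -
    interpret bounded_linear p
      by (rule p)
    have "Re t *\<^sub>R 1 + Im t *\<^sub>R \<i> = t"
      by (simp add: complex_eq_iff)
    then have "p t = Re t * p 1 + Im t * p \<i>"
      by (metis add scaleR real_scaleR_def)
    then show ?thesis
      by (simp add: c_def d_def power_int_minus circle_inverse[OF t] complex_eq_iff algebra_simps)
        (simp add: field_simps)
  qed
  fix n
  have "approximable (\<lambda>t. c \<odot> t powi (n + 1) \<odot> F t \<oplus> d \<odot> t powi (n - 1) \<odot> F t)"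
    using F by (intro approximable_add approximable_scale) (simp_all add: all_twists_approximable_def)
  then show "approximable (\<lambda>t. t powi n \<odot> complex_of_real (p t) \<odot> F t)"
  proof (rule approximable_cong[THEN iffD1, rotated])
    fix t assume "t \<in> topspace circle_topology"
    then have t: "t \<in> sphere 0 1" and Ft: "F t \<in> carrier A"
      using F by (auto simp: all_twists_approximable_def)
    have "c * t powi (n + 1) + d * t powi (n - 1) = t powi n * complex_of_real (p t)"
      using circle_power_int_add[OF t, of n 1] circle_power_int_add[OF t, of n "-1"]
      unfolding p_eq[OF t] by (simp add: algebra_simps)
    then show "c \<odot> t powi (n + 1) \<odot> F t \<oplus> d \<odot> t powi (n - 1) \<odot> F t =
        t powi n \<odot> complex_of_real (p t) \<odot> F t"
      using Ft by (simp add: scale_scale flip: scale_add_left)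
  qed
qed (simp add: all_twists_approximable_closed[OF F])

lemma all_twists_approximable_scale:
  assumes "all_twists_approximable F"
  shows "all_twists_approximable (\<lambda>t. c \<odot> F t)"
  unfolding all_twists_approximable_def
proof (intro conjI allI)
  fix n
  have "approximable (\<lambda>t. c \<odot> t powi n \<odot> F t)"
    using assms by (intro approximable_scale) (simp add: all_twists_approximable_def)
  then show "approximable (\<lambda>t. t powi n \<odot> c \<odot> F t)"
    by (rule approximable_cong[THEN iffD1, rotated])
      (simp add: all_twists_approximable_closed[OF assms] scale_scale mult.commute)
qed (simp add: all_twists_approximable_closed[OF assms])

lemma all_twists_approximable_add:
  assumes "all_twists_approximable F" "all_twists_approximable F'"
  shows "all_twists_approximable (\<lambda>t. F t \<oplus> F' t)"
  unfolding all_twists_approximable_def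
proof (intro conjI allI)
  fix n
  have "approximable (\<lambda>t. t powi n \<odot> F t \<oplus> t powi n \<odot> F' t)"
    using assms by (intro approximable_add) (simp_all add: all_twists_approximable_def)
  then show "approximable (\<lambda>t. t powi n \<odot> (F t \<oplus> F' t))"
    by (rule approximable_cong[THEN iffD1, rotated])
      (use assms in \<open>simp add: all_twists_approximable_closed scale_add_right\<close>)
qed (use assms in \<open>simp add: all_twists_approximable_closed\<close>)

lemma all_twists_approximable_cong:
  assumes "all_twists_approximable F" "\<And>t. t \<in> sphere 0 1 \<Longrightarrow> F t = F' t"
  shows "all_twists_approximable F'"
  using assms approximable_cong[of "\<lambda>t. t powi n \<odot> F t" "\<lambda>t. t powi n \<odot> F' t" for n]
  by (simp add: all_twists_approximable_def Pi_iff)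

lemma all_twists_approximable_polynomial:
  assumes "real_polynomial_function p" "all_twists_approximable F"
  shows "all_twists_approximable (\<lambda>t. complex_of_real (p t) \<odot> F t)"
  using assms
proof (induction arbitrary: F)
  case (add p q)
  have "all_twists_approximable (\<lambda>t. complex_of_real (p t) \<odot> F t \<oplus> complex_of_real (q t) \<odot> F t)"
    using add by (intro all_twists_approximable_add) simp_all
  then show ?case
    by (rule all_twists_approximable_cong)
      (simp add: all_twists_approximable_closed[OF add.prems] scale_add_left)
next
  case (mult p q)
  \<comment> \<open>The hypothesis for \<open>p\<close> is applied to the function already
    multiplied by \<open>q\<close>; hence the induction keeps \<open>F\<close> arbitrary.\<close>
  have "all_twists_approximable (\<lambda>t. complex_of_real (p t) \<odot> complex_of_real (q t) \<odot> F t)"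
    using mult by simp
  then show ?case
    by (rule all_twists_approximable_cong)
      (simp add: all_twists_approximable_closed[OF mult.prems] scale_scale)
qed (simp_all add: all_twists_approximable_linear all_twists_approximable_scale)

text \<open>By assumption the constant function \<open>a\<close> has all its twists approximable,
  hence so has every real polynomial multiple of it. The Stone-Weierstrass theorem passes to
  continuous multiples.\<close>

lemma approximable_continuous_scale:
  assumes "\<And>n. a \<in> twisted n" "continuous_on (sphere 0 1) \<phi>"
  shows "approximable (\<lambda>t. complex_of_real (\<phi> t) \<odot> a)"
proof (rule approximable_limit)
  have a: "a \<in> carrier A"
    using assms(1) twisted_closed by blast
  then show "complex_of_real (\<phi> t) \<odot> a \<in> carrier A" for t
    by simp
  fix \<epsilon> :: real assume "0 < \<epsilon>"
  \<comment> \<open>Adding 1 avoids division by zero when \<open>a = \<zero>\<close>.\<close>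
  then have "0 < \<epsilon> / (\<parallel>a\<parallel> + 1)"
    using norm_nonneg[OF a] by simp
  then obtain p where p: "real_polynomial_function p"
    "\<And>t. t \<in> sphere 0 1 \<Longrightarrow> \<bar>\<phi> t - p t\<bar> < \<epsilon> / (\<parallel>a\<parallel> + 1)"
    using Stone_Weierstrass_real_polynomial_function[OF compact_sphere assms(2)] by blast
  have "all_twists_approximable (\<lambda>t. a)"
    using assms(1) by (simp add: all_twists_approximable_def twisted_def)
  \<comment> \<open>Only the trivial twist is needed in the end; the others served the induction
    over polynomials.\<close>
  then have "approximable (\<lambda>t. t powi 0 \<odot> complex_of_real (p t) \<odot> a)"
    using all_twists_approximable_polynomial[OF p(1)] unfolding all_twists_approximable_def by blast
  then have "approximable (\<lambda>t. complex_of_real (p t) \<odot> a)"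
    using a by (simp add: scale_one)
  moreover have "cdist A (complex_of_real (\<phi> t) \<odot> a) (complex_of_real (p t) \<odot> a) < \<epsilon>"
    if t: "t \<in> sphere 0 1" for t
  proof -
    have "cdist A (complex_of_real (\<phi> t) \<odot> a) (complex_of_real (p t) \<odot> a) = \<bar>\<phi> t - p t\<bar> * \<parallel>a\<parallel>"
      using a by (simp add: cdist_scale_scale flip: of_real_diff)
    also have "\<dots> \<le> \<epsilon> / (\<parallel>a\<parallel> + 1) * \<parallel>a\<parallel>"
      using p(2)[OF t] norm_nonneg[OF a] by (intro mult_right_mono) auto
    also have "\<dots> < \<epsilon>"
      using \<open>0 < \<epsilon>\<close> norm_nonneg[OF a] by (simp add: field_simps)
    finally show ?thesis .
  qed
  ultimately show "\<exists>F. approximable F \<and>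
      (\<forall>t\<in>topspace circle_topology. cdist A (complex_of_real (\<phi> t) \<odot> a) (F t) < \<epsilon>)"
    by auto
qed

text \<open>Compactness gives a finite open cover of the circle by sets on which \<open>f\<close>
  stays within \<open>\<epsilon> / 2\<close> of its value at a centre. A subordinate partition of
  unity glues these values into a finite sum of terms treated by the preceding lemma.\<close>

lemma approximable_continuous:
  assumes twisted: "\<And>n. carrier A \<subseteq> twisted n"
    and f: "continuous_map circle_topology (norm_topology A) f"
  shows "approximable f"
proof (rule approximable_limit)
  have f_closed: "f t \<in> carrier A" if "t \<in> sphere 0 1" for t
    using f that by (auto simp: continuous_map_def norm_topology_def)
  then show "f t \<in> carrier A" if "t \<in> topspace circle_topology" for t
    using that by simp
  fix \<epsilon> :: real assume \<epsilon>: "0 < \<epsilon>"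
  have "\<exists>U. open U \<and> p \<in> U \<and> (\<forall>q\<in>U \<inter> sphere 0 1. cdist A (f p) (f q) < \<epsilon> / 2)"
    if p: "p \<in> sphere 0 1" for p
  proof -
    obtain V where "openin circle_topology V" "p \<in> V" "\<And>q. q \<in> V \<Longrightarrow> cdist A (f p) (f q) < \<epsilon> / 2"
      using continuous_map_normD[OF f, of p "\<epsilon> / 2"] p \<epsilon> by auto
    then show ?thesis
      unfolding circle_topology_def openin_open by blast
  qed
  then obtain U where U: "\<And>p. p \<in> sphere 0 1 \<Longrightarrow> open (U p)"
    "\<And>p. p \<in> sphere 0 1 \<Longrightarrow> p \<in> U p"
    "\<And>p q. \<lbrakk>p \<in> sphere 0 1; q \<in> U p \<inter> sphere 0 1\<rbrakk> \<Longrightarrow> cdist A (f p) (f q) < \<epsilon> / 2"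
    by metis
  have "sphere 0 1 \<subseteq> (\<Union>p\<in>sphere 0 1. U p)"
    using U(2) by blast
  with compact_sphere U(1) obtain I
    where I: "I \<subseteq> sphere 0 1" "finite I" "sphere 0 1 \<subseteq> (\<Union>p\<in>I. U p)"
    by (rule compactE_image)
  define \<C> where "\<C> = U ` I"
  have fin: "finite \<C>" and cover: "sphere 0 1 \<subseteq> \<Union>\<C>"
    using I by (auto simp: \<C>_def)
  have \<C>_open: "open W" if "W \<in> \<C>" for W
    using that I(1) U(1) by (auto simp: \<C>_def)
  have "\<forall>W\<in>\<C>. \<exists>p. p \<in> sphere 0 1 \<and> U p = W"
    using I(1) unfolding \<C>_def by blast
  from bchoice[OF this] obtain c where "\<forall>W\<in>\<C>. c W \<in> sphere 0 1 \<and> U (c W) = W"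
    by (elim exE)
  \<comment> \<open>The partition of unity is indexed by the sets of the cover. Different points may
    share a set \<open>U p\<close>, so one centre is chosen for each set.\<close>
  then have c: "c W \<in> sphere 0 1" "U (c W) = W" if "W \<in> \<C>" for W
    using that by simp_all
  obtain \<phi> :: "complex set \<Rightarrow> complex \<Rightarrow> real"
    where \<phi>: "\<And>W. W \<in> \<C> \<Longrightarrow> continuous_on (sphere 0 1) (\<phi> W) \<and> (\<forall>t\<in>sphere 0 1. 0 \<le> \<phi> W t)"
      "\<And>t W. \<lbrakk>W \<in> \<C>; t \<in> sphere 0 1; t \<notin> W\<rbrakk> \<Longrightarrow> \<phi> W t = 0"
      "\<And>t. t \<in> sphere 0 1 \<Longrightarrow> supp_sum (\<lambda>W. \<phi> W t) \<C> = 1"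
  proof (rule subordinate_partition_of_unity[OF cover \<C>_open])
    show "\<exists>V. open V \<and> x \<in> V \<and> finite {W \<in> \<C>. W \<inter> V \<noteq> {}}" for x
      using fin by (intro exI[of _ UNIV]) simp
  next
    fix \<phi> :: "complex set \<Rightarrow> complex \<Rightarrow> real"
    assume "\<And>W. W \<in> \<C> \<Longrightarrow> continuous_on (sphere 0 1) (\<phi> W) \<and> (\<forall>t\<in>sphere 0 1. 0 \<le> \<phi> W t)"
      "\<And>t W. \<lbrakk>W \<in> \<C>; t \<in> sphere 0 1; t \<notin> W\<rbrakk> \<Longrightarrow> \<phi> W t = 0"
      "\<And>t. t \<in> sphere 0 1 \<Longrightarrow> supp_sum (\<lambda>W. \<phi> W t) \<C> = 1"
    then show thesis
      by (rule that)
  qed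
  have sum_\<phi>: "(\<Sum>W\<in>\<C>. \<phi> W t) = 1" if "t \<in> sphere 0 1" for t
    unfolding \<phi>(3)[OF that, symmetric] supp_sum_def
    using fin by (intro sum.mono_neutral_right) (auto simp: support_on_def)
  define F where "F t = csum A (\<lambda>W. complex_of_real (\<phi> W t) \<odot> f (c W)) \<C>" for t
  have "approximable F"
    unfolding F_def using \<phi>(1)
    by (intro approximable_csum fin approximable_continuous_scale subsetD[OF twisted] f_closed c(1))
      auto
  moreover have "cdist A (f t) (F t) < \<epsilon>" if t: "t \<in> sphere 0 1" for t
  proof -
    \<comment> \<open>The weights sum to 1, so \<open>f t\<close> can be spread over the cover and
      compared with \<open>F t\<close> term by term.\<close>
    have "csum A (\<lambda>W. complex_of_real (\<phi> W t) \<odot> f t) \<C> = (\<Sum>W\<in>\<C>. complex_of_real (\<phi> W t)) \<odot> f t"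
      using fin f_closed[OF t] by (rule csum_scale_left)
    also have "\<dots> = f t"
      unfolding of_real_sum[symmetric] sum_\<phi>[OF t] using f_closed[OF t] by (simp add: scale_one)
    finally have "cdist A (f t) (F t) = cdist A (csum A (\<lambda>W. complex_of_real (\<phi> W t) \<odot> f t) \<C>) (F t)"
      by (simp only:)
    also have "\<dots> \<le>
        (\<Sum>W\<in>\<C>. cdist A (complex_of_real (\<phi> W t) \<odot> f t) (complex_of_real (\<phi> W t) \<odot> f (c W)))"
      unfolding F_def using fin t c(1) f_closed by (intro cdist_csum) auto
    also have "\<dots> \<le> (\<Sum>W\<in>\<C>. \<phi> W t * (\<epsilon> / 2))"
    proof (rule sum_mono)
      fix W assume W: "W \<in> \<C>"
      have "cdist A (f t) (f (c W)) < \<epsilon> / 2" if "t \<in> W"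
        using U(3)[of "c W" t] c[OF W] that t by (subst cdist_commute) simp
      \<comment> \<open>Either \<open>t\<close> lies in \<open>W\<close> and is controlled by its
        centre, or the weight of \<open>W\<close> vanishes at \<open>t\<close>.\<close>
      then have "cdist A (f t) (f (c W)) \<le> \<epsilon> / 2 \<or> \<phi> W t = 0"
        using \<phi>(2)[OF W t] by fastforce
      then have "\<phi> W t * cdist A (f t) (f (c W)) \<le> \<phi> W t * (\<epsilon> / 2)"
        using \<phi>(1)[OF W] t by (elim disjE) (rule mult_left_mono, auto)
      then show "cdist A (complex_of_real (\<phi> W t) \<odot> f t) (complex_of_real (\<phi> W t) \<odot> f (c W))
          \<le> \<phi> W t * (\<epsilon> / 2)"
        using \<phi>(1)[OF W] t c(1)[OF W] f_closed by (simp add: cdist_scale)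
    qed
    also have "\<dots> = \<epsilon> / 2"
      unfolding sum_distrib_right[symmetric] sum_\<phi>[OF t] by simp
    finally show ?thesis
      using \<epsilon> by simp
  qed
  ultimately show "\<exists>F. approximable F \<and> (\<forall>t\<in>topspace circle_topology. cdist A (f t) (F t) < \<epsilon>)"
    by auto
qed

section \<open>From the twisted ideals to principality\<close>

lemma principal_action_if_twisted:
  assumes "\<And>n. carrier A \<subseteq> twisted n"
  shows "principal_action circle_group circle_topology A \<gamma>"
  unfolding principal_action_def Let_def
proof (intro conjI ballI allI impI)
  fix f and \<epsilon> :: real
  let ?C = "continuous_functions circle_topology A"
  assume "f \<in> carrier ?C" and \<epsilon>: "0 < \<epsilon>"
  then have "approximable f"
    using approximable_continuous[OF assms] by (simp add: continuous_functions_def)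
  then obtain h where h: "h \<in> ellwood_range circle_topology A \<gamma>"
    "\<forall>t\<in>sphere 0 1. cdist A (f t) (h t) < \<epsilon> / 2"
    using \<epsilon> half_gt_zero[OF \<epsilon>] unfolding approximable_def topspace_circle by blast
  have norm_eq: "\<parallel>(f \<ominus>\<^bsub>?C\<^esub> h) t\<parallel> = cdist A (f t) (h t)" if "t \<in> sphere 0 1" for t
    using that approximable_closed[OF \<open>approximable f\<close>] ellwood_range_closed[OF h(1)]
    by (simp add: continuous_functions_def cminus_def cdist_eq)
  \<comment> \<open>The supremum is bounded through \<open>cSUP_least\<close>, which requires a
    nonempty index set. Pointwise bounds give only a weak inequality for the supremum, hence the
    choice of \<open>\<epsilon> / 2\<close>.\<close>
  have "(1 :: complex) \<in> sphere 0 1"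
    by simp
  then have "(SUP t\<in>sphere 0 1. \<parallel>(f \<ominus>\<^bsub>?C\<^esub> h) t\<parallel>) \<le> \<epsilon> / 2"
    using h(2) norm_eq by (intro cSUP_least) (blast, simp add: less_imp_le)
  then have "\<parallel>f \<ominus>\<^bsub>?C\<^esub> h\<parallel>\<^bsub>?C\<^esub> < \<epsilon>"
    using \<epsilon> by (simp add: continuous_functions_def)
  then show "\<exists>h\<in>ellwood_range circle_topology A \<gamma>. \<parallel>f \<ominus>\<^bsub>?C\<^esub> h\<parallel>\<^bsub>?C\<^esub> < \<epsilon>"
    using h(1) by blast
qed (rule action)

text \<open>A left ideal need not be closed under adjoints, so the generation hypothesis is applied
  to its self-adjoint part \<open>D\<close>.\<close>

lemma generates_subset_twisted:
  assumes "generates M A" "\<And>a. a \<in> M \<Longrightarrow> a \<in> twisted n" "\<And>a. a \<in> M \<Longrightarrow> a\<^sup>\<star> \<in> twisted n"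
  shows "carrier A \<subseteq> twisted n"
proof -
  define D where "D = {a \<in> twisted n. a\<^sup>\<star> \<in> twisted n}"
  have D: "a \<in> carrier A" "a \<in> twisted n" "a\<^sup>\<star> \<in> twisted n" if "a \<in> D" for a
    using that twisted_closed[of a n] by (simp_all add: D_def)
  have "closedin (norm_topology A) D"
  proof (rule closedin_norm_topologyI)
    fix a assume a: "a \<in> carrier A" "\<And>\<epsilon>. 0 < \<epsilon> \<Longrightarrow> \<exists>b\<in>D. cdist A a b < \<epsilon>"
    have "a \<in> twisted n"
      using a unfolding D_def by (intro twisted_limit) blast+
    moreover have "a\<^sup>\<star> \<in> twisted n"
    proof (rule twisted_limit)
      fix \<epsilon> :: real assume "0 < \<epsilon>"
      then obtain b where b: "b \<in> D" "cdist A a b < \<epsilon>"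
        using a(2) by blast
      then show "\<exists>b\<in>twisted n. cdist A (a\<^sup>\<star>) b < \<epsilon>"
        using cdist_adj[OF a(1) D(1)[OF b(1)]] by (intro bexI[of _ "b\<^sup>\<star>"]) (simp_all add: D_def)
    qed (simp add: a(1))
    ultimately show "a \<in> D"
      by (simp add: D_def)
  qed (use D(1) in blast)
  moreover have "\<zero> \<in> D"
    using adj_scale[of \<zero> 0] by (simp add: D_def twisted_zero)
  \<comment> \<open>For products, the right factor of \<open>a \<cdot> b\<close> is
    \<open>b\<close>, and that of its adjoint is the adjoint of \<open>a\<close>; both lie in the
    left ideal.\<close>
  moreover have "a \<oplus> b \<in> D" "a \<cdot> b \<in> D" if "a \<in> D" "b \<in> D" for a b
    using D[OF that(1)] D[OF that(2)]
    by (simp_all add: D_def adj_add adj_mult twisted_add twisted_mult_left)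
  moreover have "c \<odot> a \<in> D" "a\<^sup>\<star> \<in> D" if "a \<in> D" for c a
    using D[OF that] by (simp_all add: D_def adj_scale adj_adj twisted_scale)
  ultimately have "closed_star_subalgebra D A"
    by (simp add: closed_star_subalgebra_def)
  moreover have "M \<subseteq> D"
    using assms(2,3) by (auto simp: D_def)
  ultimately have "D = carrier A"
    using assms(1) by (simp add: generates_def)
  then show ?thesis
    by (auto simp: D_def)
qed

end

section \<open>Gauge actions\<close>

text \<open>The vertex projection is the sum of the range projections of the outgoing edges.
  Orthogonality kills every term except that of \<open>e\<close>, which fixes
  \<open>S e\<close>.\<close>

lemma (in cstar_algebra) ck_family_source:
  assumes E: "wf_digraph E" "\<forall>v\<in>verts E. finite (out_arcs E v)"
    and ck: "ck_family E A S P" and e: "e \<in> arcs E"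
  shows "P (tail E e) \<cdot> S e = S e"
proof -
  let ?O = "out_arcs E (tail E e)"
  have S [simp]: "S f \<in> carrier A" "S f \<cdot> (S f)\<^sup>\<star> \<cdot> S f = S f" if "f \<in> arcs E" for f
    using ck that by (simp_all add: ck_family_def)
  have v: "tail E e \<in> verts E"
    using E(1) e by (simp add: wf_digraph.tail_in_verts)
  have "P (tail E e) = csum A (\<lambda>f. S f \<cdot> (S f)\<^sup>\<star>) ?O"
    using ck v e unfolding ck_family_def by (auto simp: out_arcs_def)
  then have "P (tail E e) \<cdot> S e = csum A (\<lambda>f. S f \<cdot> (S f)\<^sup>\<star> \<cdot> S e) ?O"
    using E(2) v e by (simp only:) (subst csum_mult, auto)
  also have "\<dots> = S e \<cdot> (S e)\<^sup>\<star> \<cdot> S e"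
  proof (rule csum_single)
    fix f assume f: "f \<in> ?O" "f \<noteq> e"
    then have f': "f \<in> arcs E"
      by simp
    \<comment> \<open>Expanding the partial isometry \<open>S e\<close> brings its range projection
      next to that of \<open>S f\<close>.\<close>
    have "S f \<cdot> (S f)\<^sup>\<star> \<cdot> S e = (S f \<cdot> (S f)\<^sup>\<star>) \<cdot> (S e \<cdot> (S e)\<^sup>\<star> \<cdot> S e)"
      using e by simp
    also have "\<dots> = (S f \<cdot> (S f)\<^sup>\<star>) \<cdot> (S e \<cdot> (S e)\<^sup>\<star>) \<cdot> S e"
      using e f' by (intro mult_assoc[symmetric]) simp_all
    also have "(S f \<cdot> (S f)\<^sup>\<star>) \<cdot> (S e \<cdot> (S e)\<^sup>\<star>) = \<zero>"
      using ck f' f(2) e by (simp add: ck_family_def)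
    finally show "S f \<cdot> (S f)\<^sup>\<star> \<cdot> S e = \<zero>"
      using e by simp
  qed (use E(2) v e in auto)
  finally show ?thesis
    using e by simp
qed

section \<open>The generators of the graph algebra in the twisted ideals\<close>

theorem proposition2:
  fixes E :: "('v, 'e) pre_digraph"
    and A :: "'a cstar"
    and S :: "'e \<Rightarrow> 'a"
    and P :: "'v \<Rightarrow> 'a"
    and \<gamma> :: "complex \<Rightarrow> 'a \<Rightarrow> 'a"
  assumes "wf_digraph E"
    and "countable (verts E)" and "countable (arcs E)"
    and "\<forall>v\<in>verts E. finite (out_arcs E v)"
    and "\<forall>v\<in>verts E. out_arcs E v \<noteq> {}"
    and "\<forall>v\<in>verts E. in_arcs E v \<noteq> {}"
    and "graph_cstar_algebra E A S P"
    and "gauge_action E A S P \<gamma>"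
  shows "principal_action circle_group circle_topology A \<gamma>"
proof -
  interpret wf_digraph E
    by fact
  have action: "cstar_action circle_group circle_topology A \<gamma>"
    using assms(8) by (simp add: gauge_action_def)
  then interpret cstar_algebra A
    by (simp add: cstar_action_def)
  interpret circle_dynamical_system A \<gamma>
    by unfold_locales (rule action)
  have ck: "ck_family E A S P" and gen: "generates (S ` arcs E \<union> P ` verts E) A"
    using assms(7) by (simp_all add: graph_cstar_algebra_def)
  have S: "S e \<in> carrier A" "S e \<cdot>\<^bsub>A\<^esub> (S e)\<^sup>\<star>\<^bsub>A\<^esub> \<cdot>\<^bsub>A\<^esub> S e = S e"
    "(S e)\<^sup>\<star>\<^bsub>A\<^esub> \<cdot>\<^bsub>A\<^esub> S e = P (head E e)" if "e \<in> arcs E" for e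
    using ck that by (simp_all add: ck_family_def)
  have "\<forall>v\<in>verts E. P v \<in> carrier A \<and> P v \<cdot>\<^bsub>A\<^esub> P v = P v \<and> (P v)\<^sup>\<star>\<^bsub>A\<^esub> = P v"
    using ck unfolding ck_family_def by (elim conjE)
  then have P: "P v \<in> carrier A" "P v \<cdot>\<^bsub>A\<^esub> P v = P v" "(P v)\<^sup>\<star>\<^bsub>A\<^esub> = P v" if "v \<in> verts E" for v
    using that by simp_all
  have P_csum: "P v = csum A (\<lambda>f. S f \<cdot>\<^bsub>A\<^esub> (S f)\<^sup>\<star>\<^bsub>A\<^esub>) (out_arcs E v)" if "v \<in> verts E" for v
    using ck assms(5) that by (simp add: ck_family_def)
  have S_source: "P (tail E e) \<cdot>\<^bsub>A\<^esub> S e = S e" if "e \<in> arcs E" for e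
    by (rule ck_family_source[OF assms(1,4) ck that])
  have S_range: "S e \<cdot>\<^bsub>A\<^esub> P (head E e) = S e" if "e \<in> arcs E" for e
    using S(1,2)[OF that] unfolding S(3)[OF that, symmetric] by (simp flip: mult_assoc)
  \<comment> \<open>The scalar \<open>t\<close> is written as \<open>t powi 1\<close> to match the
    eigenvector hypothesis of \<open>twisted_mult_eigen\<close>.\<close>
  have gauge_S: "\<gamma> t (S e) = t powi 1 \<odot>\<^bsub>A\<^esub> S e" if "t \<in> sphere 0 1" "e \<in> arcs E" for t e
    using assms(8) that by (simp add: gauge_action_def)
  have gauge_S_adj: "\<gamma> t ((S e)\<^sup>\<star>\<^bsub>A\<^esub>) = t powi (-1) \<odot>\<^bsub>A\<^esub> (S e)\<^sup>\<star>\<^bsub>A\<^esub>"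
    if t: "t \<in> sphere 0 1" and e: "e \<in> arcs E" for t e
  proof -
    show ?thesis
      using gauge_S[OF t e] t S(1)[OF e]
      by (simp add: action_adj adj_scale power_int_minus circle_inverse)
  qed
  have P_nonneg: "P v \<in> twisted (int n)" if "v \<in> verts E" for v n
    using that
  proof (induction n arbitrary: v)
    case 0
    \<comment> \<open>The projection \<open>P v\<close> is gauge-invariant, so this elementary
      function is constantly \<open>P v\<close>.\<close>
    have "approximable (\<lambda>t. P v \<cdot>\<^bsub>A\<^esub> \<gamma> t (P v))"
      using P[OF 0] by (intro approximable_elementary)
    then have "approximable (\<lambda>t. t powi int 0 \<odot>\<^bsub>A\<^esub> P v)"
      by (rule approximable_cong[THEN iffD1, rotated])
        (use P[OF 0] assms(8) 0 in \<open>simp add: gauge_action_def scale_one\<close>)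
    then show ?case
      using P(1)[OF 0] by (simp add: twisted_def)
  next
    case (Suc n)
    \<comment> \<open>Going up in degree uses an edge into \<open>v\<close>, which exists because
      every vertex receives one.\<close>
    obtain e where e: "e \<in> arcs E" "head E e = v"
      using assms(6) Suc.prems by (auto simp: in_arcs_def)
    \<comment> \<open>The right factor \<open>S e\<close> raises the degree by 1, while the left
      factor is harmless in a left ideal.\<close>
    have "(S e)\<^sup>\<star>\<^bsub>A\<^esub> \<cdot>\<^bsub>A\<^esub> P (tail E e) \<cdot>\<^bsub>A\<^esub> S e \<in> twisted (int n + 1)"
      using Suc.IH[of "tail E e"] S(1)[OF e(1)] gauge_S e(1)
      by (intro twisted_mult_eigen twisted_mult_left) simp_all
    also have "(S e)\<^sup>\<star>\<^bsub>A\<^esub> \<cdot>\<^bsub>A\<^esub> P (tail E e) \<cdot>\<^bsub>A\<^esub> S e = P v"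
      using S[OF e(1)] P(1) S_source[OF e(1)] e by (simp add: mult_assoc)
    finally show ?case
      by (simp add: add.commute)
  qed
  have P_nonpos: "P v \<in> twisted (- int n)" if "v \<in> verts E" for v n
    using that
  proof (induction n arbitrary: v)
    case (Suc n)
    have "S e \<cdot>\<^bsub>A\<^esub> (S e)\<^sup>\<star>\<^bsub>A\<^esub> \<in> twisted (- int (Suc n))" if e: "e \<in> out_arcs E v" for e
    proof -
      have e: "e \<in> arcs E"
        using e by simp
      \<comment> \<open>Here the right factor is the adjoint of \<open>S e\<close>, of degree -1.
        The middle projection is absorbed by \<open>S e\<close> and leaves the range
        projection.\<close>
      have "S e \<cdot>\<^bsub>A\<^esub> P (head E e) \<cdot>\<^bsub>A\<^esub> (S e)\<^sup>\<star>\<^bsub>A\<^esub> \<in> twisted (- int n + -1)"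
        using Suc.IH[of "head E e"] S(1)[OF e] gauge_S_adj e
        by (intro twisted_mult_eigen twisted_mult_left) simp_all
      moreover have "- int n + -1 = - int (Suc n)"
        by simp
      ultimately show ?thesis
        by (simp only: S_range[OF e])
    qed
    then show ?case
      \<comment> \<open>All range projections of edges out of \<open>v\<close> are now in the ideal,
        and so is their finite sum \<open>P v\<close>. Going down in degree thus uses all outgoing
        edges at once.\<close>
      unfolding P_csum[OF Suc.prems] using assms(4) Suc.prems by (intro twisted_csum) simp_all
  qed (use P_nonneg[of _ 0] in simp)
  have P_twisted: "P v \<in> twisted n" if "v \<in> verts E" for v n
    using P_nonneg[OF that, of "nat n"] P_nonpos[OF that, of "nat (- n)"] by (cases "0 \<le> n") simp_all
  have "carrier A \<subseteq> twisted n" for n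
  proof (rule generates_subset_twisted[OF gen])
    have S_twisted: "S e \<in> twisted n" if e: "e \<in> arcs E" for e
      using twisted_mult_left[OF S(1)[OF e] P_twisted[of "head E e" n]] e by (simp add: S_range)
    have S_adj_twisted: "(S e)\<^sup>\<star>\<^bsub>A\<^esub> \<in> twisted n" if e: "e \<in> arcs E" for e
    proof -
      \<comment> \<open>Taking adjoints in \<open>S_source\<close> puts a vertex projection on the
        right, where the left ideal property applies.\<close>
      have "(S e)\<^sup>\<star>\<^bsub>A\<^esub> \<cdot>\<^bsub>A\<^esub> P (tail E e) = (S e)\<^sup>\<star>\<^bsub>A\<^esub>"
        using adj_mult[of "P (tail E e)" "S e"] P(1,3)[of "tail E e"] S(1)[OF e] S_source[OF e] e
        by simp
      then show ?thesis
        using twisted_mult_left[OF adj_closed[OF S(1)[OF e]] P_twisted[of "tail E e" n]] e by simp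
    qed
    show "a \<in> twisted n" "a\<^sup>\<star>\<^bsub>A\<^esub> \<in> twisted n" if "a \<in> S ` arcs E \<union> P ` verts E" for a
      using that S_twisted S_adj_twisted P_twisted P(3) by auto
  qed
  then show ?thesis
    by (rule principal_action_if_twisted)
qed

end
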